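(* For every integer $q\ge 3$, there is a $C_{2q+2}$-induced-saturated graph $G_q$.
   Context: All graphs are finite and simple (no loops and no parallel edges). $C_n$ denotes the cycle on $n$ vertices. Given a graph $H$, a graph $G$ is $H$-induced-saturated if $G$ has no induced subgraph isomorphic to $H$, but changing the adjacency of an arbitrary pair of vertices in $G$ creates an induced subgraph isomorphic to $H$. In other words, $G$ has no induced copy of $H$, every addition of an edge between a pair of non-adjacent vertices of $G$ creates an induced copy of $H$, and every deletion of an edge of $G$ creates an induced copy of $H$. *)

theory Defs
  imports "Graph_Theory.Digraph_Isomorphism" "Graph_Theory.Pair_Digraph"
begin

text \<open>
  Finite simple graphs are those satisfying \<^const>\<open>pair_graph\<close>: a finite vertex set with a finite,
  symmetric, loop-free arc relation, each edge \<open>uv\<close> being the two arcs \<open>(u, v)\<close> and \<open>(v, u)\<close>.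
\<close>

text \<open>\<open>C\<^sub>n\<close> on the vertices \<open>0, \<dots>, n - 1\<close>; only meaningful for \<open>n \<ge> 3\<close>.\<close>
definition cycle_graph :: "nat \<Rightarrow> nat pair_pre_digraph" where
  "cycle_graph n =
     \<lparr> pverts = {0..<n},
       parcs = {(i, j). i < n \<and> j < n \<and> (j = (i + 1) mod n \<or> i = (j + 1) mod n)} \<rparr>"

definition has_induced_copy :: "'b pair_pre_digraph \<Rightarrow> 'a pair_pre_digraph \<Rightarrow> bool" where
  "has_induced_copy H G \<longleftrightarrow>
     (\<exists>K. induced_subgraph K (with_proj G) \<and> digraph_iso K (with_proj H))"

definition flip_adjacency :: "'a \<Rightarrow> 'a \<Rightarrow> 'a pair_pre_digraph \<Rightarrow> 'a pair_pre_digraph" where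
  "flip_adjacency u v G =
     (if (u, v) \<in> parcs G
      then G\<lparr> parcs := parcs G - {(u, v), (v, u)} \<rparr>
      else G\<lparr> parcs := parcs G \<union> {(u, v), (v, u)} \<rparr>)"

text \<open>Every graph with at most one vertex satisfies the second conjunct vacuously.\<close>
definition induced_saturated :: "'b pair_pre_digraph \<Rightarrow> 'a pair_pre_digraph \<Rightarrow> bool" where
  "induced_saturated H G \<longleftrightarrow>
     \<not> has_induced_copy H G \<and>
     (\<forall>u \<in> pverts G. \<forall>v \<in> pverts G. u \<noteq> v \<longrightarrow> has_induced_copy H (flip_adjacency u v G))"

lemma pair_graph_cycle_graph:
  assumes "n \<ge> 3"
  shows "pair_graph (cycle_graph n)"
proof -
  have ne: "Suc i mod n \<noteq> i" if "i < n" for i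
    using assms that by (cases "Suc i = n") auto
  have fin: "finite (parcs (cycle_graph n))"
    by (rule finite_subset[of _ "{0..<n} \<times> {0..<n}"]) (auto simp: cycle_graph_def)
  show ?thesis
  proof unfold_locales
    show "symmetric (with_proj (cycle_graph n))"
      by (auto simp: symmetric_def sym_def cycle_graph_def)
  qed (use ne fin in \<open>auto simp: cycle_graph_def dest: sym\<close>)
qed

lemma pair_graph_flip_adjacency:
  assumes "pair_graph G" "u \<in> pverts G" "v \<in> pverts G" "u \<noteq> v"
  shows "pair_graph (flip_adjacency u v G)"
proof -
  interpret pair_graph G by fact
  show ?thesis
  proof unfold_locales
    show "symmetric (with_proj (flip_adjacency u v G))"
      using arcs_symmetric by (auto simp: symmetric_def sym_def flip_adjacency_def)
  qed (use assms in \<open>auto simp: flip_adjacency_def dest: in_arcsD1 in_arcsD2 no_loops'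
      split: if_splits\<close>)
qed

lemma has_induced_copy_iff:
  assumes G: "pair_graph G" and H: "pair_graph H"
  shows "has_induced_copy H G \<longleftrightarrow>
    (\<exists>f. inj_on f (pverts H) \<and> f ` pverts H \<subseteq> pverts G \<and>
         (\<forall>x \<in> pverts H. \<forall>y \<in> pverts H. (x, y) \<in> parcs H \<longleftrightarrow> (f x, f y) \<in> parcs G))"
    (is "?L \<longleftrightarrow> ?R")
proof
  interpret G: pair_graph G by fact
  interpret H: pair_graph H by fact
  assume ?L
  then obtain K h where K: "induced_subgraph K (with_proj G)"
    and h: "pre_digraph.digraph_isomorphism K h" and HK: "with_proj H = app_iso h K"
    unfolding has_induced_copy_def digraph_iso_def by blast
  let ?g = "iso_verts h"
  let ?f = "the_inv_into (verts K) ?g"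
  have tl: "tail K = fst" "head K = snd" and vK: "verts K \<subseteq> pverts G"
    and aK: "arcs K = {e \<in> parcs G. fst e \<in> verts K \<and> snd e \<in> verts K}"
    using K by (auto simp: induced_subgraph_def subgraph_def compatible_def)
  have vH: "pverts H = ?g ` verts K" and aH: "parcs H = iso_arcs h ` arcs K"
    and tH: "iso_tail h = fst" "iso_head h = snd"
    using arg_cong[OF HK, of verts] arg_cong[OF HK, of arcs]
      arg_cong[OF HK, of tail] arg_cong[OF HK, of head] by auto
  have inj: "inj_on ?g (verts K)"
    and ar: "\<And>a. a \<in> arcs K \<Longrightarrow> iso_arcs h a = (?g (fst a), ?g (snd a))"
    using h tH tl by (auto simp: pre_digraph.digraph_isomorphism_def prod_eq_iff)
  have fg: "?f (?g x) = x" if "x \<in> verts K" for x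
    using the_inv_into_f_f[OF inj that] .
  have adj: "(?g x, ?g y) \<in> parcs H \<longleftrightarrow> (x, y) \<in> parcs G" if "x \<in> verts K" "y \<in> verts K" for x y
  proof
    assume "(?g x, ?g y) \<in> parcs H"
    then obtain a where a: "a \<in> arcs K" "iso_arcs h a = (?g x, ?g y)" unfolding aH by auto
    then have v: "fst a \<in> verts K" "snd a \<in> verts K" "a \<in> parcs G" using aK by simp_all
    have "?g (fst a) = ?g x" "?g (snd a) = ?g y" using ar[OF a(1)] a(2) by simp_all
    then have "fst a = x" "snd a = y" using inj_onD[OF inj] v that by blast+
    then show "(x, y) \<in> parcs G" using v by auto
  next
    assume "(x, y) \<in> parcs G"
    then have "(x, y) \<in> arcs K" using aK that by auto
    then show "(?g x, ?g y) \<in> parcs H" unfolding aH using ar by force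
  qed
  have "inj_on ?f (pverts H)" unfolding vH by (rule inj_on_inverseI[of _ ?g]) (use fg in auto)
  moreover have "?f ` pverts H \<subseteq> pverts G" unfolding vH using fg vK by auto
  moreover have "\<forall>x \<in> pverts H. \<forall>y \<in> pverts H. (x, y) \<in> parcs H \<longleftrightarrow> (?f x, ?f y) \<in> parcs G"
    unfolding vH using fg adj by auto
  ultimately show ?R by blast
next
  interpret G: pair_graph G by fact
  interpret H: pair_graph H by fact
  assume ?R
  then obtain f where f: "inj_on f (pverts H)" "f ` pverts H \<subseteq> pverts G"
    and adj: "\<And>x y. x \<in> pverts H \<Longrightarrow> y \<in> pverts H \<Longrightarrow> (x, y) \<in> parcs H \<longleftrightarrow> (f x, f y) \<in> parcs G"
    by blast
  define K where "K = with_proj G \<restriction> (f ` pverts H)"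
  let ?g = "the_inv_into (pverts H) f"
  define h where "h = \<lparr> iso_verts = ?g, iso_arcs = (\<lambda>a. (?g (fst a), ?g (snd a))),
    iso_head = snd, iso_tail = fst \<rparr>"
  have gf: "?g (f x) = x" if "x \<in> pverts H" for x
    using the_inv_into_f_f[OF f(1) that] .
  have K: "induced_subgraph K (with_proj G)" unfolding K_def using f(2)
    by (intro G.induced_induce) auto
  have vK: "verts K = f ` pverts H" and tK: "tail K = fst" "head K = snd"
    and aK: "arcs K = {e \<in> parcs G. fst e \<in> f ` pverts H \<and> snd e \<in> f ` pverts H}"
    by (auto simp: K_def)
  have wf: "wf_digraph K" using K by (auto simp: induced_subgraph_def subgraph_def)
  have injg: "inj_on ?g (f ` pverts H)" using gf by (auto intro: inj_onI)
  have "pre_digraph.digraph_isomorphism K h"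
    unfolding pre_digraph.digraph_isomorphism_def
    using wf injg by (auto simp: h_def vK tK aK inj_on_def prod_eq_iff)
  moreover have "with_proj H = app_iso h K"
  proof -
    have "pverts H = ?g ` f ` pverts H" using gf by (force simp: image_image)
    moreover have "parcs H = (\<lambda>a. (?g (fst a), ?g (snd a))) ` arcs K" (is "_ = ?B")
    proof
      show "parcs H \<subseteq> ?B"
      proof
        fix a assume a: "a \<in> parcs H"
        obtain x y where xy: "a = (x, y)" by (cases a)
        with a have v: "x \<in> pverts H" "y \<in> pverts H" by (auto dest: H.in_arcsD1 H.in_arcsD2)
        then have "(f x, f y) \<in> arcs K" using a adj xy aK by auto
        then show "a \<in> ?B" using xy gf v by (force intro: rev_image_eqI)
      qed
      show "?B \<subseteq> parcs H" using gf adj by (auto simp: aK)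
    qed
    ultimately show ?thesis by (simp add: app_iso_def h_def with_proj_def vK)
  qed
  ultimately show ?L using K unfolding has_induced_copy_def digraph_iso_def by blast
qed

end

(*
  Take three rook's graphs K_q x K_(q+5) with columns 0, ..., q+4. Attach to each column j > 0 of
  each rook its own vertex Port, adjacent to the whole column, and one vertex Apex to column 0 of
  all three rooks. Two ports are adjacent iff they belong to different rooks.

  Inside a rook induced cycles have at most two vertices per row, hence length at most 2q. An induced
  path of cells between two columns of a rook alternates row and column steps and starts and ends with
  a row step, so it has an even number of cells. An induced cycle leaving a rook therefore is odd: up
  to such even runs it is Port-Port-Port (outer ports in one rook) or Port-Port-Apex, or it lies among
  the ports and has length at most 4. So there is no induced cycle of the even length 2q+2, while a
  flip lets a cycle pick up one more vertex, and the staircases through the rows are long enough to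
  reach length 2q+2 exactly.
*)

theory Submission
  imports Defs "HOL-Library.Countable"
begin

section \<open>Induced paths and induced cycles of a symmetric relation\<close>

text \<open>Induced paths as vertex lists. Only pairs with the earlier vertex first are constrained;
  for symmetric and irreflexive \<open>B\<close> this fixes all adjacencies on the list.\<close>

primrec ipath :: "('a \<Rightarrow> 'a \<Rightarrow> bool) \<Rightarrow> 'a list \<Rightarrow> bool" where
  "ipath B [] \<longleftrightarrow> True"
| "ipath B (x # xs) \<longleftrightarrow> ipath B xs \<and> x \<notin> set xs \<and> (\<forall>y \<in> set xs. B x y \<longleftrightarrow> y = hd xs)"

text \<open>An embedding of \<open>cycle_graph n\<close> as an induced subgraph, phrased for a bare
  relation so that a flip changes only the relation and no arc set.\<close>

definition hole :: "'a set \<Rightarrow> ('a \<Rightarrow> 'a \<Rightarrow> bool) \<Rightarrow> nat \<Rightarrow> (nat \<Rightarrow> 'a) \<Rightarrow> bool" where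
  "hole V B n h \<longleftrightarrow> inj_on h {..<n} \<and> h ` {..<n} \<subseteq> V \<and>
     (\<forall>i<n. \<forall>j<n. B (h i) (h j) \<longleftrightarrow> j = Suc i mod n \<or> i = Suc j mod n)"

definition flip_rel :: "'a \<Rightarrow> 'a \<Rightarrow> ('a \<Rightarrow> 'a \<Rightarrow> bool) \<Rightarrow> 'a \<Rightarrow> 'a \<Rightarrow> bool" where
  "flip_rel u v B x y \<longleftrightarrow> (if {x, y} = {u, v} then \<not> B x y else B x y)"

lemma flip_rel_commute: "flip_rel u v B = flip_rel v u B"
  by (simp add: flip_rel_def fun_eq_iff insert_commute)

lemma symp_flip_rel: "symp B \<Longrightarrow> symp (flip_rel u v B)"
  by (auto simp: flip_rel_def symp_def insert_commute)

lemma irreflp_flip_rel: "irreflp B \<Longrightarrow> u \<noteq> v \<Longrightarrow> irreflp (flip_rel u v B)"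
  by (auto simp: flip_rel_def irreflp_def)

lemma ipath_append:
  assumes "ipath B xs" "ipath B ys" "xs \<noteq> []" "ys \<noteq> []" "set xs \<inter> set ys = {}"
    and "\<And>x y. x \<in> set xs \<Longrightarrow> y \<in> set ys \<Longrightarrow> B x y \<longleftrightarrow> x = last xs \<and> y = hd ys"
  shows "ipath B (xs @ ys)"
  using assms
proof (induction xs)
  case (Cons x xs)
  show ?case
  proof (cases "xs = []")
    case False
    have "ipath B (xs @ ys)"
      by (rule Cons.IH) (use Cons.prems False in auto)
    moreover have "x \<noteq> last xs" "hd xs \<in> set xs"
      using Cons.prems False by auto
    then have "x \<noteq> last xs" "hd xs \<notin> set ys"
      using Cons.prems by auto
    ultimately show ?thesis using Cons.prems False by auto
  qed (use Cons.prems in auto)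
qed simp

lemma ipath_cong:
  assumes "ipath B xs" "\<And>x y. x \<in> set xs \<Longrightarrow> y \<in> set xs \<Longrightarrow> B x y \<longleftrightarrow> C x y"
  shows "ipath C xs"
  using assms by (induction xs) auto

lemma ipath_distinct: "ipath B xs \<Longrightarrow> distinct xs"
  by (induction xs) auto

lemma ipath_nth:
  assumes "ipath B xs" "i < j" "j < length xs"
  shows "B (xs ! i) (xs ! j) \<longleftrightarrow> j = Suc i"
  using assms
proof (induction xs arbitrary: i j)
  case (Cons x xs)
  then obtain k where k: "j = Suc k" "k < length xs" by (cases j) auto
  show ?case
  proof (cases i)
    case 0
    have "xs ! k = hd xs \<longleftrightarrow> k = 0"
      using k Cons.prems(1) by (metis ipath.simps(2) ipath_distinct hd_conv_nth length_0_conv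
          length_greater_0_conv less_nat_zero_code nth_eq_iff_index_eq)
    then show ?thesis using 0 k Cons.prems by auto
  qed (use Cons k in auto)
qed simp

text \<open>Every cycle created by a flip is closed here. The new vertex gets index 0 and the path
  the indices from 1 on, so the only wrap-around edge joins \<open>x\<close> to
  \<open>last ys\<close>.\<close>

lemma hole_of_ipath:
  assumes B: "symp B" "irreflp B"
    and ys: "ipath B ys" "x \<notin> set ys" "2 \<le> length ys" "insert x (set ys) \<subseteq> V"
    and x: "\<And>y. y \<in> set ys \<Longrightarrow> B x y \<longleftrightarrow> y = hd ys \<or> y = last ys"
  shows "hole V B (Suc (length ys)) ((!) (x # ys))"
proof -
  let ?n = "Suc (length ys)"
  have d: "distinct ys" using ys ipath_distinct by blast
  have xi: "B x (ys ! i) \<longleftrightarrow> i = 0 \<or> Suc i = length ys" if "i < length ys" for i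
  proof -
    have "ys \<noteq> []" using ys(3) by auto
    then have "ys ! i = hd ys \<longleftrightarrow> i = 0" "ys ! i = last ys \<longleftrightarrow> i = length ys - 1"
      using that d by (simp_all add: hd_conv_nth last_conv_nth nth_eq_iff_index_eq)
    then show ?thesis using x that by auto
  qed
  have adj: "B ((x # ys) ! i) ((x # ys) ! j) \<longleftrightarrow> j = Suc i mod ?n \<or> i = Suc j mod ?n"
    if ij: "i < j" "j < ?n" for i j
  proof -
    obtain k where k: "j = Suc k" "k < length ys" using ij by (cases j) auto
    show ?thesis
    proof (cases i)
      case 0
      then show ?thesis using xi k ys(3) by (auto simp: mod_Suc)
    next
      case (Suc l)
      then show ?thesis using ipath_nth[OF ys(1), of l k] k ij by (auto simp: mod_Suc)
    qed
  qed
  have "B ((x # ys) ! i) ((x # ys) ! j) \<longleftrightarrow> j = Suc i mod ?n \<or> i = Suc j mod ?n"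
    if "i < ?n" "j < ?n" for i j
  proof (cases i j rule: linorder_cases)
    case less
    then show ?thesis using adj that by blast
  next
    case equal
    then show ?thesis using B(2) ys(3) that by (auto simp: irreflp_def mod_Suc)
  next
    case greater
    then show ?thesis using adj[of j i] that B(1) by (auto simp: symp_def)
  qed
  moreover have "inj_on ((!) (x # ys)) {..<?n}"
    using d ys(2) by (intro inj_on_nth) auto
  moreover have "(!) (x # ys) ` {..<?n} \<subseteq> V"
    using ys(4) by (fastforce simp: nth_Cons split: nat.splits)
  ultimately show ?thesis unfolding hole_def by blast
qed

text \<open>The edge \<open>uv\<close> is the only new adjacency. Once \<open>u\<close> is split
  off, the rest is still an induced path, and \<open>u\<close> now sees exactly its two ends: the
  old path neighbour and \<open>v\<close>.\<close>

lemma hole_add_edge: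
  assumes B: "symp B" "irreflp B" "\<not> B u v"
    and p: "ipath B ps" "hd ps = u" "last ps = v" "length ps = n" "4 \<le> n" "set ps \<subseteq> V"
  shows "\<exists>h. hole V (flip_rel u v B) n h"
proof -
  obtain ys where ps: "ps = u # ys" using p by (cases ps) auto
  then have "ys \<noteq> []" using p by auto
  then have v: "last ys = v" "v \<in> set ys" "u \<notin> set ys" using p ps by auto
  have "hole V (flip_rel u v B) (Suc (length ys)) ((!) (u # ys))"
  proof (rule hole_of_ipath)
    show "ipath (flip_rel u v B) ys"
      by (rule ipath_cong[of B]) (use p ps v in \<open>auto simp: flip_rel_def doubleton_eq_iff\<close>)
    show "flip_rel u v B u y \<longleftrightarrow> y = hd ys \<or> y = last ys" if "y \<in> set ys" for y
      using that p ps v B by (auto simp: flip_rel_def doubleton_eq_iff)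
  qed (use assms ps v in \<open>auto intro: symp_flip_rel irreflp_flip_rel\<close>)
  then show ?thesis using p ps by auto
qed

text \<open>Here \<open>u # ys\<close> is an induced \<open>(n - 1)\<close>-cycle through \<open>uv\<close>; the detour \<open>u g v\<close> replaces the deleted
  edge.\<close>
lemma hole_delete_edge:
  assumes B: "symp B" "irreflp B" "B u v"
    and p: "ipath B ys" "hd ys = v" "2 \<le> length ys" "insert u (insert g (set ys)) \<subseteq> V"
      "n = length ys + 2"
    and u: "u \<notin> set ys" "\<And>y. y \<in> set ys \<Longrightarrow> B u y \<longleftrightarrow> y = v \<or> y = last ys"
    and g: "g \<notin> set ys" "B g u" "\<And>y. y \<in> set ys \<Longrightarrow> B g y \<longleftrightarrow> y = v"
  shows "\<exists>h. hole V (flip_rel u v B) n h"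
proof -
  let ?C = "flip_rel u v B"
  have C: "symp ?C" "irreflp ?C"
    using B symp_flip_rel[of B u v] irreflp_flip_rel[of B u v] by (auto simp: irreflp_def)
  have gu: "g \<noteq> u" using B g by (auto simp: irreflp_def)
  have v: "v \<in> set ys" using p by (cases ys) auto
  have "last ys \<noteq> v"
    using p ipath_distinct[OF p(1)] by (cases ys) auto
  have Cu: "?C y u \<longleftrightarrow> y = last ys" if "y \<in> set ys" for y
  proof -
    have "?C y u \<longleftrightarrow> ?C u y" using C by (auto simp: symp_def)
    also have "\<dots> \<longleftrightarrow> y = last ys"
      using that u \<open>last ys \<noteq> v\<close> B by (auto simp: flip_rel_def doubleton_eq_iff)
    finally show ?thesis .
  qed
  have "hole V ?C (Suc (length (ys @ [u]))) ((!) (g # (ys @ [u])))"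
  proof (rule hole_of_ipath)
    have "ipath ?C ys"
      by (rule ipath_cong[OF p(1)]) (use u in \<open>auto simp: flip_rel_def doubleton_eq_iff\<close>)
    then show "ipath ?C (ys @ [u])"
      by (rule ipath_append) (use p u Cu in auto)
    show "?C g y \<longleftrightarrow> y = hd (ys @ [u]) \<or> y = last (ys @ [u])" if "y \<in> set (ys @ [u])" for y
    proof -
      have "hd (ys @ [u]) = v" using v p(2) by (cases ys) auto
      then show ?thesis
        using that g p(2) v gu by (auto simp: flip_rel_def doubleton_eq_iff)
    qed
  qed (use assms C gu in auto)
  then show ?thesis using p by auto
qed

section \<open>Encoding a relation as a graph on natural numbers\<close>

definition graph_of :: "('a :: countable) set \<Rightarrow> ('a \<Rightarrow> 'a \<Rightarrow> bool) \<Rightarrow> nat pair_pre_digraph" where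
  "graph_of V B = \<lparr> pverts = to_nat ` V,
     parcs = map_prod to_nat to_nat ` {(x, y). x \<in> V \<and> y \<in> V \<and> B x y} \<rparr>"

lemma parcs_graph_of [simp]:
  "(to_nat x, to_nat y) \<in> parcs (graph_of V B) \<longleftrightarrow> x \<in> V \<and> y \<in> V \<and> B x y"
  by (auto simp: graph_of_def)

lemma pair_graph_graph_of:
  assumes "finite V" "symp B" "irreflp B"
  shows "pair_graph (graph_of V B)"
proof -
  have "parcs (graph_of V B) \<subseteq> to_nat ` V \<times> to_nat ` V"
    by (auto simp: graph_of_def)
  then have "finite (parcs (graph_of V B))"
    by (rule finite_subset) (use assms in auto)
  moreover have "symmetric (with_proj (graph_of V B))"
    using assms(2) by (auto simp: symmetric_def sym_def symp_def graph_of_def)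
  ultimately show ?thesis
    using assms by unfold_locales (auto simp: graph_of_def irreflp_def dest: sym)
qed

lemma flip_adjacency_graph_of:
  assumes "symp B" "u \<in> V" "v \<in> V"
  shows "flip_adjacency (to_nat u) (to_nat v) (graph_of V B) = graph_of V (flip_rel u v B)"
proof -
  let ?E = "\<lambda>B. {(x, y). x \<in> V \<and> y \<in> V \<and> B x y}" and ?f = "map_prod to_nat to_nat :: 'a \<times> 'a \<Rightarrow> _"
  have "?E (flip_rel u v B) = (if B u v then ?E B - {(u, v), (v, u)} else ?E B \<union> {(u, v), (v, u)})"
    using assms by (auto simp: flip_rel_def doubleton_eq_iff symp_def)
  moreover have "inj ?f" by (simp add: prod.inj_map)
  ultimately have "?f ` ?E (flip_rel u v B) = (if B u v
      then ?f ` ?E B - {(to_nat u, to_nat v), (to_nat v, to_nat u)}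
      else ?f ` ?E B \<union> {(to_nat u, to_nat v), (to_nat v, to_nat u)})"
    by (simp add: image_set_diff)
  then show ?thesis
    using assms(2,3) by (simp add: flip_adjacency_def) (simp add: graph_of_def)
qed

text \<open>Since \<open>to_nat\<close> is injective, embeddings into the encoded graph correspond
  to embeddings into \<open>V\<close> by composition with \<open>to_nat\<close>.\<close>

lemma has_induced_copy_graph_of:
  assumes "finite V" "symp B" "irreflp B" "3 \<le> n"
  shows "has_induced_copy (cycle_graph n) (graph_of V B) \<longleftrightarrow> (\<exists>h. hole V B n h)"
proof -
  let ?G = "graph_of V B"
  have iff: "has_induced_copy (cycle_graph n) ?G \<longleftrightarrow>
    (\<exists>f. inj_on f {..<n} \<and> f ` {..<n} \<subseteq> to_nat ` V \<and>
       (\<forall>i<n. \<forall>j<n. j = Suc i mod n \<or> i = Suc j mod n \<longleftrightarrow> (f i, f j) \<in> parcs ?G))"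
  proof -
    have "pverts (cycle_graph n) = {..<n}" "pverts ?G = to_nat ` V"
      by (auto simp: cycle_graph_def graph_of_def)
    moreover have "(i, j) \<in> parcs (cycle_graph n) \<longleftrightarrow> j = Suc i mod n \<or> i = Suc j mod n"
      if "i < n" "j < n" for i j
      using that by (auto simp: cycle_graph_def)
    ultimately show ?thesis
      using has_induced_copy_iff[OF pair_graph_graph_of[OF assms(1-3)]
          pair_graph_cycle_graph[OF assms(4)]]
      by (simp add: Ball_def)
  qed
  show ?thesis
  proof
    assume "has_induced_copy (cycle_graph n) ?G"
    then obtain f where f: "inj_on f {..<n}" "f ` {..<n} \<subseteq> to_nat ` V"
      "\<And>i j. i < n \<Longrightarrow> j < n \<Longrightarrow> j = Suc i mod n \<or> i = Suc j mod n \<longleftrightarrow> (f i, f j) \<in> parcs ?G"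
      unfolding iff by blast
    have "\<exists>x. x \<in> V \<and> to_nat x = f i" if "i < n" for i
      using f(2) that by (force simp: subset_iff image_iff)
    then obtain h where h: "\<And>i. i < n \<Longrightarrow> h i \<in> V" "\<And>i. i < n \<Longrightarrow> to_nat (h i) = f i"
      by metis
    have "inj_on h {..<n}"
      using f(1) h unfolding inj_on_def by (metis lessThan_iff)
    moreover have "B (h i) (h j) \<longleftrightarrow> j = Suc i mod n \<or> i = Suc j mod n" if "i < n" "j < n" for i j
      using f(3)[OF that] h that parcs_graph_of[of "h i" "h j" V B] by simp
    ultimately show "\<exists>h. hole V B n h"
      unfolding hole_def using h by (intro exI[of _ h]) auto
  next
    assume "\<exists>h. hole V B n h"
    then obtain h where h: "inj_on h {..<n}" "h ` {..<n} \<subseteq> V"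
      "\<And>i j. i < n \<Longrightarrow> j < n \<Longrightarrow> B (h i) (h j) \<longleftrightarrow> j = Suc i mod n \<or> i = Suc j mod n"
      unfolding hole_def by blast
    have "inj_on (to_nat \<circ> h) {..<n}" using h(1) by (auto simp: inj_on_def)
    moreover have "(to_nat \<circ> h) ` {..<n} \<subseteq> to_nat ` V" using h(2) by auto
    moreover have "j = Suc i mod n \<or> i = Suc j mod n \<longleftrightarrow>
        ((to_nat \<circ> h) i, (to_nat \<circ> h) j) \<in> parcs ?G" if "i < n" "j < n" for i j
      using h(3)[OF that] h(2) that by auto
    ultimately show "has_induced_copy (cycle_graph n) ?G"
      unfolding iff by blast
  qed
qed

section \<open>The construction\<close>

datatype vert = is_Cell: Cell (rook: nat) (row: nat) (col: nat) | is_Port: Port nat nat | Apex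

instance vert :: countable
  by countable_datatype

text \<open>\<open>Port a 0\<close> is never a vertex: \<open>Apex\<close> takes its place in all three rooks.\<close>
definition port :: "nat \<Rightarrow> nat \<Rightarrow> vert" where
  "port a j = (if j = 0 then Apex else Port a j)"

text \<open>For two cells the inequality of truth values is an exclusive or: exactly one coordinate
  agrees, which is adjacency in a rook's graph. Through \<open>port\<close>, \<open>Apex\<close>
  acts as the port of column 0 in every rook; the last clause keeps it away from all other
  ports.\<close>

fun adj :: "vert \<Rightarrow> vert \<Rightarrow> bool" where
  "adj (Cell a i j) (Cell b k l) \<longleftrightarrow> a = b \<and> (i = k) \<noteq> (j = l)"
| "adj (Cell a i j) t \<longleftrightarrow> t = port a j"
| "adj t (Cell a i j) \<longleftrightarrow> t = port a j"
| "adj (Port a j) (Port b l) \<longleftrightarrow> a \<noteq> b"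
| "adj _ _ \<longleftrightarrow> False"

text \<open>A staircase through at most \<open>q\<close> rows takes at most \<open>q\<close> new
  columns; the other five allow it to avoid column 0, its starting column and up to three more. The
  third rook provides common neighbours for ports of the other two.\<close>

definition verts_of :: "nat \<Rightarrow> vert set" where
  "verts_of q = {Cell a i j | a i j. a < 3 \<and> i < q \<and> j < q + 5} \<union>
     {Port a j | a j. a < 3 \<and> 0 < j \<and> j < q + 5} \<union> {Apex}"

lemma Cell_in_verts_of [simp]: "Cell a i j \<in> verts_of q \<longleftrightarrow> a < 3 \<and> i < q \<and> j < q + 5"
  and Port_in_verts_of [simp]: "Port a j \<in> verts_of q \<longleftrightarrow> a < 3 \<and> 0 < j \<and> j < q + 5"
  and Apex_in_verts_of [simp]: "Apex \<in> verts_of q"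
  by (auto simp: verts_of_def)

lemma symp_adj: "symp adj"
proof (rule sympI)
  show "adj y x" if "adj x y" for x y
    using that by (cases x; cases y) (auto simp: port_def split: if_splits)
qed

lemma irreflp_adj: "irreflp adj"
proof (rule irreflpI)
  show "\<not> adj x x" for x by (cases x) auto
qed

lemma finite_verts_of: "finite (verts_of q)"
proof -
  have "verts_of q \<subseteq> (\<lambda>(a, i, j). Cell a i j) ` ({..<3} \<times> {..<q} \<times> {..<q + 5}) \<union>
      (\<lambda>(a, j). Port a j) ` ({..<3} \<times> {..<q + 5}) \<union> {Apex}"
    by (force simp: verts_of_def)
  then show ?thesis by (rule finite_subset) auto
qed

text \<open>A staircase in rook \<open>a\<close>: cross row \<open>r\<close> from the current column
  \<open>x\<close> to \<open>y\<close>, then move inside column \<open>y\<close> to the next row. It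
  has two cells in each row, starts in column \<open>x\<close> and ends in column
  \<open>last ys\<close>.\<close>

fun zig :: "nat \<Rightarrow> nat \<Rightarrow> nat list \<Rightarrow> nat list \<Rightarrow> vert list" where
  "zig a x (r # rs) (y # ys) = Cell a r x # Cell a r y # zig a y rs ys"
| "zig a x _ _ = []"

lemma length_zig: "length rs = length ys \<Longrightarrow> length (zig a x rs ys) = 2 * length rs"
  by (induction a x rs ys rule: zig.induct) auto

lemma zig_cell: "z \<in> set (zig a x rs ys) \<Longrightarrow> \<exists>r c. z = Cell a r c \<and> r \<in> set rs \<and> c \<in> insert x (set ys)"
  by (induction a x rs ys rule: zig.induct) auto

lemma hd_zig: "length rs = length ys \<Longrightarrow> rs \<noteq> [] \<Longrightarrow> hd (zig a x rs ys) = Cell a (hd rs) x"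
  by (cases rs; cases ys) auto

lemma last_zig:
  "length rs = length ys \<Longrightarrow> rs \<noteq> [] \<Longrightarrow> last (zig a x rs ys) = Cell a (last rs) (last ys)"
proof (induction a x rs ys rule: zig.induct)
  case (1 a x r rs y ys)
  then show ?case by (cases rs; cases ys) auto
qed auto

text \<open>An inner column of a staircase holds two of its cells, the first and the last column
  only one each. Hence the port of an end column sees just the end cell.\<close>

lemma zig_first_column:
  assumes "Cell a r x \<in> set (zig a x rs ys)" "distinct (x # ys)"
  shows "r = hd rs"
  using assms by (cases "(a, x, rs, ys)" rule: zig.cases) (auto dest: zig_cell)

lemma zig_last_column:
  assumes "Cell a r (last ys) \<in> set (zig a x rs ys)" "distinct (x # ys)" "length rs = length ys"
  shows "r = last rs"
  using assms
proof (induction a x rs ys rule: zig.induct)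
  case (1 a x r' rs y ys)
  then show ?case
  proof (cases "ys = []")
    case False
    then have "last ys \<in> set ys" "rs \<noteq> []" using 1 by auto
    then show ?thesis using 1 False by auto
  qed auto
qed auto

text \<open>As rows and columns are distinct, two cells share a row only when they are the two ends
  of a row step, and a column only at a turn; both pairs are consecutive.\<close>

lemma ipath_zig:
  "distinct rs \<Longrightarrow> distinct (x # ys) \<Longrightarrow> length rs = length ys \<Longrightarrow> ipath adj (zig a x rs ys)"
proof (induction a x rs ys rule: zig.induct)
  case (1 a x r rs y ys)
  have IH: "ipath adj (zig a y rs ys)" using 1 by auto
  \<comment> \<open>Column \<open>y\<close> meets the remaining staircase only in its first cell, so
    this cell is the only later neighbour of \<open>Cell a r y\<close>.\<close>
  have *: "\<exists>r' c. z = Cell a r' c \<and> r' \<in> set rs \<and> c \<in> insert y (set ys) \<and> (c = y \<longleftrightarrow> z = hd (zig a y rs ys))"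
    if z: "z \<in> set (zig a y rs ys)" for z
  proof -
    obtain r' c where c: "z = Cell a r' c" "r' \<in> set rs" "c \<in> insert y (set ys)"
      using zig_cell[OF z] by blast
    then have "hd (zig a y rs ys) = Cell a (hd rs) y"
      using 1(4) by (intro hd_zig) auto
    then show ?thesis using c z zig_first_column[of a r' y rs ys] 1(3) by auto
  qed
  have "Cell a r x \<notin> set (zig a y rs ys)" "Cell a r y \<notin> set (zig a y rs ys)"
    using 1(2,3) by (auto dest!: *)
  moreover have "adj (Cell a r y) z \<longleftrightarrow> z = hd (zig a y rs ys)" "\<not> adj (Cell a r x) z"
    if z: "z \<in> set (zig a y rs ys)" for z
  proof -
    obtain r' c where c: "z = Cell a r' c" "r' \<in> set rs" "c \<in> insert y (set ys)"
      "c = y \<longleftrightarrow> z = hd (zig a y rs ys)"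
      using *[OF z] by blast
    have "adj (Cell a r y) z \<longleftrightarrow> c = y" "\<not> adj (Cell a r x) z"
      using c(1-3) 1(2,3) by auto
    then show "adj (Cell a r y) z \<longleftrightarrow> z = hd (zig a y rs ys)" "\<not> adj (Cell a r x) z"
      using c(4) by auto
  qed
  ultimately show ?case using IH 1(2,3) by auto
qed auto

section \<open>Staircases and the effect of a flip\<close>

lemma port_eq_iff [simp]: "port a j = port a l \<longleftrightarrow> j = l"
  by (simp add: port_def)

lemma port_eq_simps [simp]:
  "port a j = Port b l \<longleftrightarrow> a = b \<and> j = l \<and> 0 < l" "Port b l = port a j \<longleftrightarrow> a = b \<and> j = l \<and> 0 < l"
  "port a j = Apex \<longleftrightarrow> j = 0" "Apex = port a j \<longleftrightarrow> j = 0"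
  "port a j \<noteq> Cell b i l" "Cell b i l \<noteq> port a j"
  by (auto simp: port_def)

lemma adj_port [simp]: "adj (Cell a i j) (port b l) \<longleftrightarrow> port b l = port a j"
  "adj (port b l) (Cell a i j) \<longleftrightarrow> port b l = port a j"
  by (auto simp: port_def)

text \<open>The supply of rows and columns for the staircases.\<close>

lemma pick:
  assumes "t + length fs \<le> N"
  obtains xs where "distinct xs" "length xs = t" "\<And>x. x \<in> set xs \<Longrightarrow> x < N \<and> x \<notin> set fs"
proof -
  have "t \<le> card ({..<N} - set fs)"
    using assms card_length[of fs] diff_card_le_card_Diff[of "set fs" "{..<N}"] by simp
  then obtain T where T: "T \<subseteq> {..<N} - set fs" "card T = t" "finite T"
    by (meson obtain_subset_with_card_n)
  then obtain xs where xs: "set xs = T" "distinct xs" using finite_distinct_list by blast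
  show thesis
  proof (rule that)
    show "distinct xs" "length xs = t" using xs T distinct_card[of xs] by auto
    show "x < N \<and> x \<notin> set fs" if "x \<in> set xs" for x using that xs T by auto
  qed
qed

definition stair :: "nat \<Rightarrow> nat \<Rightarrow> nat \<Rightarrow> nat list \<Rightarrow> nat list \<Rightarrow> bool" where
  "stair q a x rs ys \<longleftrightarrow> a < 3 \<and> distinct rs \<and> distinct (x # ys) \<and> length rs = length ys \<and>
     rs \<noteq> [] \<and> set rs \<subseteq> {..<q} \<and> set (x # ys) \<subseteq> {..<q + 5}"

text \<open>The end columns are used once, so each end is recognised by its column alone. This turns
  adjacency to a port of an end column into equality with an end cell.\<close>

lemma stair_cell:
  assumes "stair q a x rs ys" "z \<in> set (zig a x rs ys)"
  obtains r c where "z = Cell a r c" "r \<in> set rs" "c \<in> insert x (set ys)"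
    "z = hd (zig a x rs ys) \<longleftrightarrow> c = x" "z = last (zig a x rs ys) \<longleftrightarrow> c = last ys"
proof -
  obtain r c where c: "z = Cell a r c" "r \<in> set rs" "c \<in> insert x (set ys)"
    using zig_cell[OF assms(2)] by blast
  have d: "distinct (x # ys)" "length rs = length ys" "rs \<noteq> []"
    using assms(1) by (auto simp: stair_def)
  have "r = hd rs" if "c = x"
    by (rule zig_first_column[of a r x rs ys]) (use assms(2) c(1) that d in simp_all)
  then have "z = hd (zig a x rs ys) \<longleftrightarrow> c = x"
    unfolding hd_zig[OF d(2,3)] c(1) by auto
  moreover have "r = last rs" if "c = last ys"
    by (rule zig_last_column[of a r ys x rs]) (use assms(2) c(1) that d in simp_all)
  then have "z = last (zig a x rs ys) \<longleftrightarrow> c = last ys"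
    unfolding last_zig[OF d(2,3)] c(1) by auto
  ultimately show thesis using that[OF c] by blast
qed

lemma stair_zig:
  assumes "stair q a x rs ys"
  shows "ipath adj (zig a x rs ys)" "zig a x rs ys \<noteq> []" "set (zig a x rs ys) \<subseteq> verts_of q"
    "length (zig a x rs ys) = 2 * length rs" "hd (zig a x rs ys) = Cell a (hd rs) x"
proof -
  show "ipath adj (zig a x rs ys)" using assms by (intro ipath_zig) (auto simp: stair_def)
  show l: "length (zig a x rs ys) = 2 * length rs"
    using assms by (intro length_zig) (auto simp: stair_def)
  then show "zig a x rs ys \<noteq> []" using assms by (auto simp: stair_def)
  show "set (zig a x rs ys) \<subseteq> verts_of q"
  proof
    fix z assume "z \<in> set (zig a x rs ys)"
    then obtain r c where "z = Cell a r c" "r \<in> set rs" "c \<in> insert x (set ys)"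
      using stair_cell[OF assms] by metis
    then show "z \<in> verts_of q"
      using assms by (auto simp: stair_def verts_of_def)
  qed
  show "hd (zig a x rs ys) = Cell a (hd rs) x"
    using assms by (intro hd_zig) (auto simp: stair_def)
qed

text \<open>The port of the last column meets the staircase in its last cell only, so it is the
  single link to a tail \<open>ts\<close> that stays away from the cells.\<close>

lemma ipath_zig_append:
  assumes st: "stair q a x rs ys"
    and ts: "ipath adj (port a (last ys) # ts)"
    and far: "\<And>w r c. w \<in> set ts \<Longrightarrow> r \<in> set rs \<Longrightarrow> c \<in> insert x (set ys) \<Longrightarrow>
      w \<noteq> Cell a r c \<and> \<not> adj (Cell a r c) w"
  shows "ipath adj (zig a x rs ys @ port a (last ys) # ts)"
proof (rule ipath_append)
  show "adj z w \<longleftrightarrow> z = last (zig a x rs ys) \<and> w = hd (port a (last ys) # ts)"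
    if z: "z \<in> set (zig a x rs ys)" and w: "w \<in> set (port a (last ys) # ts)" for z w
  proof -
    obtain r c where c: "z = Cell a r c" "r \<in> set rs" "c \<in> insert x (set ys)"
      and l: "z = last (zig a x rs ys) \<longleftrightarrow> c = last ys"
      using stair_cell[OF st z] by metis
    have "port a (last ys) \<notin> set ts" using ts by auto
    then show ?thesis
      unfolding l using c w far[of w r c] by auto
  qed
  show "set (zig a x rs ys) \<inter> set (port a (last ys) # ts) = {}"
  proof (intro equals0I, elim IntE)
    fix z assume z: "z \<in> set (zig a x rs ys)" "z \<in> set (port a (last ys) # ts)"
    from stair_cell[OF st z(1)] obtain r c where
      "z = Cell a r c" "r \<in> set rs" "c \<in> insert x (set ys)" by metis
    then show False using far z(2) by (auto simp: port_def split: if_splits)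
  qed
qed (use assms stair_zig[OF st] in auto)

text \<open>Both kinds of \<open>v\<close> meet the staircase only through column \<open>x\<close>,
  where it has just its first cell; a cell \<open>v\<close> lies in a row that the staircase does
  not use.\<close>

lemma ipath_Cons_zig:
  assumes st: "stair q a x rs ys"
    and p: "ipath adj (zig a x rs ys @ ts)"
    and v: "v = port a x \<or> (\<exists>i. v = Cell a i x \<and> i \<notin> set rs)"
    and far: "\<And>w. w \<in> set ts \<Longrightarrow> w \<noteq> v \<and> \<not> adj v w"
  shows "ipath adj (v # zig a x rs ys @ ts)"
proof -
  have ne: "zig a x rs ys \<noteq> []" "hd (zig a x rs ys) = Cell a (hd rs) x"
    using stair_zig[OF st] by auto
  have "v \<noteq> z \<and> (adj v z \<longleftrightarrow> z = hd (zig a x rs ys))" if z: "z \<in> set (zig a x rs ys)" for z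
  proof -
    obtain r c where c: "z = Cell a r c" "r \<in> set rs" "c \<in> insert x (set ys)"
      and h: "z = hd (zig a x rs ys) \<longleftrightarrow> c = x"
      using stair_cell[OF st z] by metis
    have "v \<noteq> z" using v c by (auto simp: port_def split: if_splits)
    then show ?thesis unfolding h using v c by auto
  qed
  moreover have "hd (zig a x rs ys) \<notin> set ts"
    using ipath_distinct[OF p] hd_in_set[OF ne(1)] by auto
  ultimately show ?thesis using p far ne(1) by auto
qed

abbreviation "flippable q u v \<equiv> \<exists>h. hole (verts_of q) (flip_rel u v adj) (2 * q + 2) h"

lemma flippable_add:
  assumes "\<not> adj u v" "ipath adj ps" "hd ps = u" "last ps = v" "length ps = 2 * q + 2"
    "3 \<le> q" "set ps \<subseteq> verts_of q"
  shows "flippable q u v"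
  using assms by (intro hole_add_edge[OF symp_adj irreflp_adj]) auto

text \<open>Together with \<open>u\<close>, the path is an induced cycle of the odd length
  \<open>2 * q + 1\<close>; replacing the edge \<open>uv\<close> by the detour through
  \<open>g\<close> adds the missing vertex.\<close>

lemma flippable_delete:
  assumes "adj u v" "ipath adj ps" "hd ps = v" "length ps = 2 * q" "1 \<le> q"
    "set ps \<subseteq> verts_of q" "u \<in> verts_of q" "g \<in> verts_of q" "u \<notin> set ps" "g \<notin> set ps" "adj g u"
    "\<And>y. y \<in> set ps \<Longrightarrow> adj u y \<longleftrightarrow> y = v \<or> y = last ps"
    "\<And>y. y \<in> set ps \<Longrightarrow> adj g y \<longleftrightarrow> y = v"
  shows "flippable q u v"
  using assms by (intro hole_delete_edge[OF symp_adj irreflp_adj, where ys = ps and g = g]) auto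

lemma flippable_commute: "flippable q u v \<longleftrightarrow> flippable q v u"
  by (simp add: flip_rel_commute)

lemma other_rook: obtains b :: nat where "b < 3" "b \<noteq> a"
  by (cases "a = 0") (use that[of 0] that[of 1] in auto)

text \<open>At most \<open>q\<close> columns are chosen outside a list of at most five, which fits
  into \<open>q + 5\<close>. Avoiding column 0 makes the exit a genuine \<open>Port\<close>, from
  which the other rooks can be reached.\<close>

lemma obtain_stair:
  assumes "a < 3" "x < q + 5" "distinct rs" "rs \<noteq> []" "set rs \<subseteq> {..<q}"
    "length fs \<le> 3"
  obtains ys where "stair q a x rs ys" "last ys \<in> set ys" "0 < last ys" "last ys < q + 5"
    "set ys \<inter> set (0 # x # fs) = {}"
proof -
  have "length rs \<le> q"
    using assms(3,5) distinct_card[of rs] card_mono[of "{..<q}" "set rs"] by simp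
  then obtain ys where ys: "distinct ys" "length ys = length rs"
    "\<And>c. c \<in> set ys \<Longrightarrow> c < q + 5 \<and> c \<notin> set (0 # x # fs)"
    using pick[of "length rs" "0 # x # fs" "q + 5"] assms(6) by auto
  have "ys \<noteq> []" using ys(2) assms(4) by auto
  then have l: "last ys \<in> set ys" by simp
  moreover have "stair q a x rs ys"
    using ys assms(1-5) by (auto simp: stair_def)
  moreover have "0 < last ys" "last ys < q + 5" using ys(3)[OF l] by auto
  ultimately show thesis using that ys(3) by blast
qed

text \<open>The variant with a prescribed last column, which may be 0, so that a staircase can also
  leave through \<open>Apex\<close>.\<close>

lemma obtain_stair_to:
  assumes "a < 3" "x < q + 5" "z < q + 5" "x \<noteq> z" "distinct rs" "rs \<noteq> []" "set rs \<subseteq> {..<q}"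
  obtains ys where "stair q a x rs ys" "last ys = z" "set ys \<inter> {x} = {}"
proof -
  have "length rs \<le> q"
    using assms(5,7) distinct_card[of rs] card_mono[of "{..<q}" "set rs"] by simp
  obtain ys where ys: "distinct ys" "length ys = length rs - 1"
    "\<And>c. c \<in> set ys \<Longrightarrow> c < q + 5 \<and> c \<notin> set [x, z]"
    by (rule pick[of "length rs - 1" "[x, z]" "q + 5"]) (use \<open>length rs \<le> q\<close> in auto)
  have "stair q a x rs (ys @ [z])"
    using ys assms by (auto simp: stair_def)
  moreover have "set (ys @ [z]) \<inter> {x} = {}" using ys(3) assms(4) by auto
  ultimately show thesis using that[of "ys @ [z]"] by simp
qed

lemma stair_last: "stair q a x rs ys \<Longrightarrow> last ys \<in> set ys"
  by (cases ys) (auto simp: stair_def)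

text \<open>Ports of one rook are pairwise non-adjacent, so the path passes from one to another
  through a port of rook \<open>b\<close>. Column \<open>j\<close> contains no cell of the path, so
  \<open>Port a j\<close> sees none.\<close>

lemma ipath_row_detour:
  assumes st: "stair q a x rs ys" and "a \<noteq> b" "i \<notin> set rs" "0 < j" "j \<notin> insert x (set ys)"
    "0 < last ys"
  shows "ipath adj (Cell a i x # zig a x rs ys @ [Port a (last ys), Port b 1, Port a j])"
proof (rule ipath_Cons_zig[OF st])
  have "last ys \<in> set ys" using st by (rule stair_last)
  then have "ipath adj (zig a x rs ys @ port a (last ys) # [Port b 1, Port a j])"
    by (intro ipath_zig_append[OF st]) (use assms in \<open>auto simp: port_def split: if_splits\<close>)
  then show "ipath adj (zig a x rs ys @ [Port a (last ys), Port b 1, Port a j])"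
    using assms by (simp add: port_def)
  show "w \<noteq> Cell a i x \<and> \<not> adj (Cell a i x) w"
    if "w \<in> set [Port a (last ys), Port b 1, Port a j]" for w
    using that assms stair_last[OF st] st by (auto simp: port_def stair_def split: if_splits)
qed (use assms in auto)

lemma ipath_return:
  assumes st: "stair q a x rs ys" and "a \<noteq> b" "k \<notin> set rs" "0 < l" "l \<notin> insert x (set ys)"
    "0 < last ys"
  shows "ipath adj (zig a x rs ys @ [Port a (last ys), Port b 1, Port a l, Cell a k l])"
proof -
  have "last ys \<in> set ys" using st by (rule stair_last)
  then have "ipath adj (zig a x rs ys @ port a (last ys) # [Port b 1, Port a l, Cell a k l])"
    by (intro ipath_zig_append[OF st]) (use assms in \<open>auto simp: port_def split: if_splits\<close>)
  then show ?thesis using assms by (simp add: port_def)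
qed

lemma ipath_cross:
  assumes st: "stair q a x rs ys" and "a \<noteq> b" "0 < y" "y \<noteq> l" "0 < last ys"
  shows "ipath adj (zig a x rs ys @ [Port a (last ys), Port b y, Cell b k y, Cell b k l])"
proof -
  have "ipath adj (zig a x rs ys @ port a (last ys) # [Port b y, Cell b k y, Cell b k l])"
    by (intro ipath_zig_append[OF st]) (use assms in \<open>auto simp: port_def split: if_splits\<close>)
  then show ?thesis using assms by (simp add: port_def)
qed

section \<open>Adding a missing edge\<close>

lemma flippable_cells_same_rook_nonadj:
  assumes q: "3 \<le> q" and u: "a < 3" "i < q" "j < q + 5" and v: "k < q" "l < q + 5"
    and ne: "i \<noteq> k" "j \<noteq> l" "0 < l"
  shows "flippable q (Cell a i j) (Cell a k l)"
proof -
  obtain b where b: "b < 3" "b \<noteq> a" by (rule other_rook)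
  obtain rs where rs: "distinct rs" "length rs = q - 2" "\<And>r. r \<in> set rs \<Longrightarrow> r < q \<and> r \<notin> set [i, k]"
    by (rule pick[of "q - 2" "[i, k]" q]) (use q in auto)
  obtain ys where ys: "stair q a j (i # rs) ys" "last ys \<in> set ys" "0 < last ys" "last ys < q + 5"
    "set ys \<inter> set (0 # j # [l]) = {}"
    by (rule obtain_stair[of a j q "i # rs" "[l]"]) (use u rs in auto)
  \<comment> \<open>The staircase takes all rows except \<open>k\<close>, which gives
    \<open>2 * (q - 1) + 4\<close> vertices. Its cells avoid row \<open>k\<close> and column
    \<open>l\<close>, so the last cell sees none of them; \<open>0 < l\<close> makes
    \<open>Port a l\<close> a vertex.\<close>
  let ?ps = "zig a j (i # rs) ys @ [Port a (last ys), Port b 1, Port a l, Cell a k l]"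
  show ?thesis
  proof (rule flippable_add)
    show "ipath adj ?ps"
      by (rule ipath_return[OF ys(1)]) (use b rs ys ne in auto)
    show "hd ?ps = Cell a i j" "length ?ps = 2 * q + 2"
      using stair_zig[OF ys(1)] rs(2) q by auto
    show "set ?ps \<subseteq> verts_of q"
      using stair_zig(3)[OF ys(1)] u v b ys ne q by (auto simp: verts_of_def)
  qed (use ne q in auto)
qed

lemma flippable_cells_different_rooks:
  assumes q: "3 \<le> q" and u: "a < 3" "i < q" "j < q + 5" and v: "b < 3" "k < q" "l < q + 5"
    and ne: "a \<noteq> b"
  shows "flippable q (Cell a i j) (Cell b k l)"
proof -
  obtain rs where rs: "distinct rs" "length rs = q - 2" "\<And>r. r \<in> set rs \<Longrightarrow> r < q \<and> r \<notin> set [i]"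
    by (rule pick[of "q - 2" "[i]" q]) (use q in auto)
  obtain ys where ys: "stair q a j (i # rs) ys" "last ys \<in> set ys" "0 < last ys" "last ys < q + 5"
    by (rule obtain_stair[of a j q "i # rs" "[]"]) (use u rs in auto)
  obtain y where y: "0 < y" "y \<noteq> l" "y < q + 5"
    by (cases "l = 1") (use that[of 1] that[of 2] in auto)
  \<comment> \<open>Again \<open>q - 1\<close> rows and four further vertices. The choice
    \<open>y \<noteq> l\<close> makes the last step a row step, and \<open>0 < y\<close> makes
    \<open>Port b y\<close> a vertex.\<close>
  let ?ps = "zig a j (i # rs) ys @ [Port a (last ys), Port b y, Cell b k y, Cell b k l]"
  show ?thesis
  proof (rule flippable_add)
    show "ipath adj ?ps"
      by (rule ipath_cross[OF ys(1)]) (use ys y ne in auto)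
    show "hd ?ps = Cell a i j" "length ?ps = 2 * q + 2"
      using stair_zig[OF ys(1)] rs(2) q by auto
    show "set ?ps \<subseteq> verts_of q"
      using stair_zig(3)[OF ys(1)] u v y ys ne q by (auto simp: verts_of_def)
  qed (use ne q in auto)
qed

lemma flippable_cell_port_same_rook_nonadj:
  assumes q: "3 \<le> q" and u: "a < 3" "i < q" "k < q + 5" and v: "0 < j" "j < q + 5"
    and ne: "j \<noteq> k"
  shows "flippable q (Cell a i k) (Port a j)"
proof -
  obtain b where b: "b < 3" "b \<noteq> a" by (rule other_rook)
  obtain rs where rs: "distinct rs" "length rs = q - 1" "\<And>r. r \<in> set rs \<Longrightarrow> r < q \<and> r \<notin> set [i]"
    by (rule pick[of "q - 1" "[i]" q]) (use q in auto)
  obtain ys where ys: "stair q a k rs ys" "last ys \<in> set ys" "0 < last ys" "last ys < q + 5"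
    "set ys \<inter> set (0 # k # [j]) = {}"
    by (rule obtain_stair[of a k q rs "[j]"]) (use u rs q in auto)
  \<comment> \<open>Row \<open>i\<close> contributes only the starting cell, and the staircase takes
    the other \<open>q - 1\<close> rows: \<open>1 + 2 * (q - 1) + 3\<close> vertices.\<close>
  let ?ps = "Cell a i k # zig a k rs ys @ [Port a (last ys), Port b 1, Port a j]"
  show ?thesis
  proof (rule flippable_add)
    show "ipath adj ?ps"
      by (rule ipath_row_detour[OF ys(1)]) (use b rs ys ne v in auto)
    show "length ?ps = 2 * q + 2"
      using stair_zig[OF ys(1)] rs(2) q by auto
    show "set ?ps \<subseteq> verts_of q"
      using stair_zig(3)[OF ys(1)] u v b ys ne q by (auto simp: verts_of_def)
  qed (use ne q v in \<open>auto simp: port_def\<close>)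
qed

lemma flippable_cell_port_different_rooks:
  assumes q: "3 \<le> q" and u: "a < 3" "i < q" "k < q + 5" and v: "b < 3" "0 < j" "j < q + 5"
    and ne: "a \<noteq> b"
  shows "flippable q (Cell a i k) (Port b j)"
proof -
  obtain rs where rs: "distinct rs" "length rs = q - 1" "\<And>r. r \<in> set rs \<Longrightarrow> r < q \<and> r \<notin> set [i]"
    by (rule pick[of "q - 1" "[i]" q]) (use q in auto)
  obtain ys where ys: "stair q a k (i # rs) ys" "last ys \<in> set ys" "0 < last ys" "last ys < q + 5"
    by (rule obtain_stair[of a k q "i # rs" "[]"]) (use u rs in auto)
  \<comment> \<open>The staircase takes all \<open>q\<close> rows, and the two ports complete the
    length.\<close>
  let ?ps = "zig a k (i # rs) ys @ [Port a (last ys), Port b j]"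
  show ?thesis
  proof (rule flippable_add)
    show "ipath adj ?ps"
    proof -
      have "ipath adj (zig a k (i # rs) ys @ port a (last ys) # [Port b j])"
        by (intro ipath_zig_append[OF ys(1)])
          (use ys ne v in \<open>auto simp: port_def split: if_splits\<close>)
      then show ?thesis using ys by (simp add: port_def)
    qed
    show "hd ?ps = Cell a i k" "length ?ps = 2 * q + 2"
      using stair_zig[OF ys(1)] rs(2) q by auto
    show "set ?ps \<subseteq> verts_of q"
      using stair_zig(3)[OF ys(1)] u v ys q by (auto simp: verts_of_def)
  qed (use ne q v in \<open>auto simp: port_def\<close>)
qed

lemma flippable_cell_apex_nonadj:
  assumes q: "3 \<le> q" and u: "a < 3" "i < q" "0 < k" "k < q + 5"
  shows "flippable q (Cell a i k) Apex"
proof -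
  obtain b where b: "b < 3" "b \<noteq> a" by (rule other_rook)
  obtain rs where rs: "distinct rs" "length rs = q - 2" "\<And>r. r \<in> set rs \<Longrightarrow> r < q \<and> r \<notin> set [i]"
    by (rule pick[of "q - 2" "[i]" q]) (use q in auto)
  obtain ys where ys: "stair q a k rs ys" "last ys \<in> set ys" "0 < last ys" "last ys < q + 5"
    "set ys \<inter> set (0 # k # []) = {}"
    by (rule obtain_stair[of a k q rs "[]"]) (use u rs q in auto)
  \<comment> \<open>No port is adjacent to \<open>Apex\<close>, so it is approached through column 0
    of another rook. The part of the path in rook \<open>a\<close> avoids column 0. The count is
    \<open>1 + 2 * (q - 2) + 5\<close>.\<close>
  let ?ts = "[Port b 1, Cell b 0 1, Cell b 0 0, Apex]"
  let ?ps = "Cell a i k # zig a k rs ys @ Port a (last ys) # ?ts"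
  show ?thesis
  proof (rule flippable_add)
    show "ipath adj ?ps"
    proof (rule ipath_Cons_zig[OF ys(1)])
      show "ipath adj (zig a k rs ys @ Port a (last ys) # ?ts)"
      proof -
        have "ipath adj (zig a k rs ys @ port a (last ys) # ?ts)"
          by (intro ipath_zig_append[OF ys(1)])
            (use ys b u in \<open>auto simp: port_def split: if_splits\<close>)
        then show ?thesis using ys by (simp add: port_def)
      qed
      show "w \<noteq> Cell a i k \<and> \<not> adj (Cell a i k) w" if "w \<in> set (Port a (last ys) # ?ts)" for w
        using that ys b u by (auto simp: port_def split: if_splits)
    qed (use rs in auto)
    show "length ?ps = 2 * q + 2"
      using stair_zig[OF ys(1)] rs(2) q by auto
    show "set ?ps \<subseteq> verts_of q"
      using stair_zig(3)[OF ys(1)] u b ys q by (auto simp: verts_of_def)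
  qed (use q u in \<open>auto simp: port_def\<close>)
qed

text \<open>A staircase through all \<open>q\<close> rows joins the two columns. Using
  \<open>port\<close> covers the pairs of a port and \<open>Apex\<close> as well, by taking column
  0.\<close>

lemma flippable_ports_same_rook:
  assumes q: "3 \<le> q" and u: "a < 3" "j < q + 5" "k < q + 5" and ne: "j \<noteq> k"
  shows "flippable q (port a j) (port a k)"
proof -
  obtain rs where rs: "distinct rs" "length rs = q" "\<And>r. r \<in> set rs \<Longrightarrow> r < q"
    by (rule pick[of q "[]" q]) (use q in auto)
  obtain ys where ys: "stair q a j rs ys" "last ys = k"
    by (rule obtain_stair_to[of a j q k rs]) (use u rs q ne in auto)
  let ?ps = "port a j # zig a j rs ys @ [port a k]"
  have pp: "\<not> adj (port a j) (port a k)" "port a j \<in> verts_of q" "port a k \<in> verts_of q"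
    using u by (auto simp: port_def verts_of_def)
  show ?thesis
  proof (rule flippable_add)
    show "ipath adj ?ps"
    proof (rule ipath_Cons_zig[OF ys(1)])
      show "ipath adj (zig a j rs ys @ [port a k])"
        using ipath_zig_append[OF ys(1), of "[]"] ys by auto
    qed (use pp ne in auto)
    show "length ?ps = 2 * q + 2"
      using stair_zig[OF ys(1)] rs(2) q by auto
    show "set ?ps \<subseteq> verts_of q"
      using stair_zig(3)[OF ys(1)] pp by auto
  qed (use q pp in auto)
qed

section \<open>Deleting an edge\<close>

lemma flippable_cells_same_row:
  assumes q: "3 \<le> q" and u: "a < 3" "i < q" "0 < j" "j < q + 5" "k < q + 5"
    and ne: "j \<noteq> k"
  shows "flippable q (Cell a i j) (Cell a i k)"
proof -
  obtain b where b: "b < 3" "b \<noteq> a" by (rule other_rook)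
  obtain m where m: "m \<noteq> j" "m \<noteq> k" "m < q + 5"
    by (cases "j = 1 \<or> k = 1"; cases "j = 2 \<or> k = 2")
      (use that[of 1] that[of 2] that[of 3] ne in auto)
  obtain rs where rs: "distinct rs" "length rs = q - 2" "\<And>r. r \<in> set rs \<Longrightarrow> r < q \<and> r \<notin> set [i]"
    by (rule pick[of "q - 2" "[i]" q]) (use q in auto)
  obtain ys where ys: "stair q a k rs ys" "last ys \<in> set ys" "0 < last ys" "last ys < q + 5"
    "set ys \<inter> set (0 # k # [j, m]) = {}"
    by (rule obtain_stair[of a k q rs "[j, m]"]) (use u rs q in auto)
  let ?z = "zig a k rs ys"
  \<comment> \<open>The path ends in \<open>Port a j\<close>, the second neighbour of
    \<open>Cell a i j\<close> on the cycle. The detour is \<open>Cell a i m\<close>: it shares row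
    \<open>i\<close> with both cells, and neither row \<open>i\<close> nor column \<open>m\<close>
    offers it another neighbour on the path.\<close>
  let ?ps = "Cell a i k # ?z @ [Port a (last ys), Port b 1, Port a j]"
  have z: "\<exists>r c. y = Cell a r c \<and> r \<noteq> i \<and> c \<noteq> j \<and> c \<noteq> m" if "y \<in> set ?z" for y
    using zig_cell[OF that] rs(3) ys(5) ne m by fastforce
  show ?thesis
  proof (rule flippable_delete)
    show "ipath adj ?ps"
      by (rule ipath_row_detour[OF ys(1)]) (use b rs ys ne u in auto)
    show "length ?ps = 2 * q"
      using stair_zig[OF ys(1)] rs(2) q by auto
    show "set ?ps \<subseteq> verts_of q"
      using stair_zig(3)[OF ys(1)] u b ys ne q by (auto simp: verts_of_def)
    show "adj (Cell a i j) y \<longleftrightarrow> y = Cell a i k \<or> y = last ?ps" if "y \<in> set ?ps" for y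
      using that z[of y] ys b ne u by auto
    show "adj (Cell a i m) y \<longleftrightarrow> y = Cell a i k" if "y \<in> set ?ps" for y
      using that z[of y] ys b ne u m by auto
    show "Cell a i j \<notin> set ?ps" "Cell a i m \<notin> set ?ps"
      using z[of "Cell a i j"] z[of "Cell a i m"] ne m by auto
    show "Cell a i j \<in> verts_of q" "Cell a i m \<in> verts_of q"
      using u m by (auto simp: verts_of_def)
  qed (use ne q m in auto)
qed

text \<open>The detour is a cell of the same column in a third row \<open>m\<close>, which exists as
  \<open>3 \<le> q\<close>. The staircase takes the \<open>q - 2\<close> rows other than
  \<open>i\<close> and \<open>m\<close>, and the path returns to row \<open>i\<close> in a fresh
  column \<open>l\<close>.\<close>

lemma flippable_cells_same_column:
  assumes q: "3 \<le> q" and u: "a < 3" "i < q" "k < q" "j < q + 5" and ne: "i \<noteq> k"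
  shows "flippable q (Cell a i j) (Cell a k j)"
proof -
  obtain b where b: "b < 3" "b \<noteq> a" by (rule other_rook)
  obtain m where m: "m \<noteq> i" "m \<noteq> k" "m < q"
    by (cases "i = 0 \<or> k = 0"; cases "i = 1 \<or> k = 1")
      (use that[of 0] that[of 1] that[of 2] ne q in auto)
  obtain l where l: "0 < l" "l \<noteq> j" "l < q + 5"
    by (cases "j = 1") (use that[of 1] that[of 2] in auto)
  obtain rs where rs: "distinct rs" "length rs = q - 3"
    "\<And>r. r \<in> set rs \<Longrightarrow> r < q \<and> r \<notin> set [i, k, m]"
    by (rule pick[of "q - 3" "[i, k, m]" q]) (use q in auto)
  obtain ys where ys: "stair q a j (k # rs) ys" "last ys \<in> set ys" "0 < last ys" "last ys < q + 5"
    "set ys \<inter> set (0 # j # [l]) = {}"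
    by (rule obtain_stair[of a j q "k # rs" "[l]"]) (use u rs q in auto)
  let ?z = "zig a j (k # rs) ys"
  let ?ps = "?z @ [Port a (last ys), Port b 1, Port a l, Cell a i l]"
  have z: "\<exists>r c. y = Cell a r c \<and> r \<noteq> i \<and> r \<noteq> m \<and> (y = Cell a k j \<longleftrightarrow> c = j)"
    if y: "y \<in> set ?z" for y
  proof -
    obtain r c where c: "y = Cell a r c" "r \<in> set (k # rs)" "c \<in> insert j (set ys)"
      "y = hd ?z \<longleftrightarrow> c = j"
      using stair_cell[OF ys(1) y] by metis
    then show ?thesis using stair_zig(5)[OF ys(1)] rs(3) ne m by auto
  qed
  show ?thesis
  proof (rule flippable_delete)
    show "ipath adj ?ps"
      by (rule ipath_return[OF ys(1)]) (use b rs ys ne l in auto)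
    show "length ?ps = 2 * q" "hd ?ps = Cell a k j"
      using stair_zig[OF ys(1)] rs(2) q by auto
    show "set ?ps \<subseteq> verts_of q"
      using stair_zig(3)[OF ys(1)] u b ys ne q l by (auto simp: verts_of_def)
    show "adj (Cell a i j) y \<longleftrightarrow> y = Cell a k j \<or> y = last ?ps" if "y \<in> set ?ps" for y
      using that z[of y] ys b ne u l by auto
    show "adj (Cell a m j) y \<longleftrightarrow> y = Cell a k j" if "y \<in> set ?ps" for y
      using that z[of y] ys b ne u m l by auto
    show "Cell a i j \<notin> set ?ps" "Cell a m j \<notin> set ?ps"
      using z[of "Cell a i j"] z[of "Cell a m j"] ne m l by auto
    show "Cell a i j \<in> verts_of q" "Cell a m j \<in> verts_of q"
      using u m by (auto simp: verts_of_def)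
  qed (use ne q m in auto)
qed

lemma flippable_cell_port_adj:
  assumes q: "3 \<le> q" and u: "a < 3" "i < q" "0 < j" "j < q + 5"
  shows "flippable q (Port a j) (Cell a i j)"
proof -
  obtain b where b: "b < 3" "b \<noteq> a" by (rule other_rook)
  obtain m where m: "m \<noteq> i" "m < q"
    by (cases "i = 0") (use that[of 0] that[of 1] q in auto)
  obtain rs where rs: "distinct rs" "length rs = q - 2"
    "\<And>r. r \<in> set rs \<Longrightarrow> r < q \<and> r \<notin> set [i, m]"
    by (rule pick[of "q - 2" "[i, m]" q]) (use q in auto)
  obtain ys where ys: "stair q a j (i # rs) ys" "last ys \<in> set ys" "0 < last ys" "last ys < q + 5"
    "set ys \<inter> set (0 # j # []) = {}"
    by (rule obtain_stair[of a j q "i # rs" "[]"]) (use u rs q in auto)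
  let ?z = "zig a j (i # rs) ys"
  let ?ps = "?z @ [Port a (last ys), Port b 1]"
  have z: "\<exists>r c. y = Cell a r c \<and> r \<noteq> m \<and> (y = Cell a i j \<longleftrightarrow> c = j)"
    if y: "y \<in> set ?z" for y
  proof -
    obtain r c where c: "y = Cell a r c" "r \<in> set (i # rs)" "c \<in> insert j (set ys)"
      "y = hd ?z \<longleftrightarrow> c = j"
      using stair_cell[OF ys(1) y] by metis
    then show ?thesis using stair_zig(5)[OF ys(1)] rs(3) m by auto
  qed
  show ?thesis
  proof (rule flippable_delete)
    have "ipath adj (?z @ port a (last ys) # [Port b 1])"
      by (intro ipath_zig_append[OF ys(1)])
        (use ys b in \<open>auto simp: port_def split: if_splits\<close>)
    then show "ipath adj ?ps" using ys by (simp add: port_def)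
    show "length ?ps = 2 * q" "hd ?ps = Cell a i j"
      using stair_zig[OF ys(1)] rs(2) q by auto
    show "set ?ps \<subseteq> verts_of q"
      using stair_zig(3)[OF ys(1)] u b ys q by (auto simp: verts_of_def)
    show "adj (Port a j) y \<longleftrightarrow> y = Cell a i j \<or> y = last ?ps" if "y \<in> set ?ps" for y
      using that z[of y] ys b u by auto
    show "adj (Cell a m j) y \<longleftrightarrow> y = Cell a i j" if "y \<in> set ?ps" for y
      using that z[of y] ys b u m by auto
    show "Port a j \<notin> set ?ps" "Cell a m j \<notin> set ?ps"
      using z[of "Port a j"] z[of "Cell a m j"] m b ys by auto
    show "Port a j \<in> verts_of q" "Cell a m j \<in> verts_of q"
      using u m by (auto simp: verts_of_def)
  qed (use q m u in auto)
qed

lemma flippable_cell_apex_adj: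
  assumes q: "3 \<le> q" and u: "a < 3" "i < q"
  shows "flippable q Apex (Cell a i 0)"
proof -
  obtain b where b: "b < 3" "b \<noteq> a" by (rule other_rook)
  obtain m where m: "m \<noteq> i" "m < q"
    by (cases "i = 0") (use that[of 0] that[of 1] q in auto)
  obtain rs where rs: "distinct rs" "length rs = q - 3"
    "\<And>r. r \<in> set rs \<Longrightarrow> r < q \<and> r \<notin> set [i, m]"
    by (rule pick[of "q - 3" "[i, m]" q]) (use q in auto)
  obtain ys where ys: "stair q a 0 (i # rs) ys" "last ys \<in> set ys" "0 < last ys" "last ys < q + 5"
    by (rule obtain_stair[of a 0 q "i # rs" "[]"]) (use u rs q in auto)
  let ?z = "zig a 0 (i # rs) ys"
  let ?ps = "?z @ [Port a (last ys), Port b 1, Cell b 0 1, Cell b 0 0]"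
  have z: "\<exists>r c. y = Cell a r c \<and> r \<noteq> m \<and> (y = Cell a i 0 \<longleftrightarrow> c = 0)"
    if y: "y \<in> set ?z" for y
  proof -
    obtain r c where c: "y = Cell a r c" "r \<in> set (i # rs)" "c \<in> insert 0 (set ys)"
      "y = hd ?z \<longleftrightarrow> c = 0"
      using stair_cell[OF ys(1) y] by metis
    then show ?thesis using stair_zig(5)[OF ys(1)] rs(3) m by auto
  qed
  show ?thesis
  proof (rule flippable_delete)
    show "ipath adj ?ps"
      by (rule ipath_cross[OF ys(1)]) (use b ys in auto)
    show "length ?ps = 2 * q" "hd ?ps = Cell a i 0"
      using stair_zig[OF ys(1)] rs(2) q by auto
    show "set ?ps \<subseteq> verts_of q"
      using stair_zig(3)[OF ys(1)] u b ys q by (auto simp: verts_of_def)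
    show "adj Apex y \<longleftrightarrow> y = Cell a i 0 \<or> y = last ?ps" if "y \<in> set ?ps" for y
      using that z[of y] ys b u by auto
    show "adj (Cell a m 0) y \<longleftrightarrow> y = Cell a i 0" if "y \<in> set ?ps" for y
      using that z[of y] ys b u m by auto
    show "Apex \<notin> set ?ps" "Cell a m 0 \<notin> set ?ps"
      using z[of "Apex"] z[of "Cell a m 0"] m b by auto
    show "Apex \<in> verts_of q" "Cell a m 0 \<in> verts_of q"
      using u m by (auto simp: verts_of_def)
  qed (use q m u in auto)
qed

text \<open>Here the third rook is used: \<open>Port c 1\<close> sees both ports and nothing else on
  the cycle. The path runs from rook \<open>b\<close> through \<open>Apex\<close> into rook
  \<open>a\<close>, with \<open>1 + 2 * (q - 2) + 3\<close> vertices.\<close>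

lemma flippable_ports_different_rooks:
  assumes q: "3 \<le> q" and u: "a < 3" "0 < j" "j < q + 5" and v: "b < 3" "0 < k" "k < q + 5"
    and ne: "a \<noteq> b"
  shows "flippable q (Port a j) (Port b k)"
proof -
  obtain c where c: "c < 3" "c \<noteq> a" "c \<noteq> b"
    by (cases "a = 0 \<or> b = 0"; cases "a = 1 \<or> b = 1")
      (use that[of 0] that[of 1] that[of 2] ne in auto)
  obtain rs where rs: "distinct rs" "length rs = q - 2" "\<And>r. r \<in> set rs \<Longrightarrow> r < q"
    by (rule pick[of "q - 2" "[]" q]) (use q in auto)
  obtain ys where ys: "stair q b k rs ys" "last ys = 0"
    by (rule obtain_stair_to[of b k q 0 rs]) (use v rs q in auto)
  let ?z = "zig b k rs ys"
  let ?ts = "[Cell a 0 0, Cell a 0 j]"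
  let ?ps = "Port b k # ?z @ Apex # ?ts"
  have z: "\<exists>r c. y = Cell b r c" if "y \<in> set ?z" for y
    using zig_cell[OF that] by blast
  show ?thesis
  proof (rule flippable_delete)
    show "ipath adj ?ps"
    proof (rule ipath_Cons_zig[OF ys(1)])
      have "ipath adj (?z @ port b (last ys) # ?ts)"
        by (intro ipath_zig_append[OF ys(1)])
          (use ys ne u in \<open>auto simp: port_def split: if_splits\<close>)
      then show "ipath adj (?z @ Apex # ?ts)" using ys(2) by (simp add: port_def)
      show "w \<noteq> Port b k \<and> \<not> adj (Port b k) w" if "w \<in> set (Apex # ?ts)" for w
        using that ne v by (auto simp: port_def split: if_splits)
    qed (use v in \<open>auto simp: port_def\<close>)
    show "length ?ps = 2 * q"
      using stair_zig[OF ys(1)] rs(2) q by auto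
    show "set ?ps \<subseteq> verts_of q"
      using stair_zig(3)[OF ys(1)] u v q by (auto simp: verts_of_def)
    show "adj (Port a j) y \<longleftrightarrow> y = Port b k \<or> y = last ?ps" if "y \<in> set ?ps" for y
      using that z[of y] ne u by auto
    show "adj (Port c 1) y \<longleftrightarrow> y = Port b k" if "y \<in> set ?ps" for y
      using that z[of y] ne c by auto
    show "Port a j \<notin> set ?ps" "Port c 1 \<notin> set ?ps"
      using z[of "Port a j"] z[of "Port c 1"] ne c by auto
    show "Port a j \<in> verts_of q" "Port c 1 \<in> verts_of q"
      using u c by (auto simp: verts_of_def)
  qed (use q ne c in auto)
qed

section \<open>Flips of arbitrary pairs\<close>

lemma flippable_port_apex:
  assumes "3 \<le> q" "a < 3" "0 < j" "j < q + 5"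
  shows "flippable q (Port a j) Apex"
  using flippable_ports_same_rook[of q a j 0] assms by (simp add: port_def)

lemma flippable_ports:
  assumes "3 \<le> q" "a < 3" "b < 3" "0 < j" "j < q + 5" "0 < k" "k < q + 5" "Port a j \<noteq> Port b k"
  shows "flippable q (Port a j) (Port b k)"
proof (cases "a = b")
  case True
  then show ?thesis using flippable_ports_same_rook[of q a j k] assms by (simp add: port_def)
next
  case False
  then show ?thesis by (intro flippable_ports_different_rooks) (use assms in simp_all)
qed

lemma flippable_cells:
  assumes q: "3 \<le> q" and u: "a < 3" "i < q" "j < q + 5" and v: "b < 3" "k < q" "l < q + 5"
    and ne: "Cell a i j \<noteq> Cell b k l"
  shows "flippable q (Cell a i j) (Cell b k l)"
proof -
  consider "a \<noteq> b" | "a = b" "i = k" "j \<noteq> l" | "a = b" "i \<noteq> k" "j = l" | "a = b" "i \<noteq> k" "j \<noteq> l"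
    using ne by auto
  then show ?thesis
  proof cases
    case 1
    then show ?thesis by (intro flippable_cells_different_rooks) (use assms in simp_all)
  next
    case 2
    show ?thesis
    \<comment> \<open>The path used for two cells of one row ends in the port of the first cell,
      whose column must therefore be nonzero; as \<open>j \<noteq> l\<close>, one of the two orders
      qualifies.\<close>
    proof (cases "j = 0")
      case True
      have "flippable q (Cell a i l) (Cell a i j)"
        by (rule flippable_cells_same_row) (use assms 2 True in simp_all)
      then show ?thesis using 2 by (subst flippable_commute) simp
    next
      case False
      have "flippable q (Cell a i j) (Cell a i l)"
        by (rule flippable_cells_same_row) (use assms 2 False in simp_all)
      then show ?thesis using 2 by simp
    qed
  next
    case 3
    have "flippable q (Cell a i j) (Cell a k j)"
      by (rule flippable_cells_same_column) (use assms 3 in simp_all)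
    then show ?thesis using 3 by simp
  next
    case 4
    show ?thesis
    proof (cases "l = 0")
      case True
      have "flippable q (Cell a k l) (Cell a i j)"
        by (rule flippable_cells_same_rook_nonadj) (use assms 4 True in simp_all)
      then show ?thesis using 4 by (subst flippable_commute) simp
    next
      case False
      have "flippable q (Cell a i j) (Cell a k l)"
        by (rule flippable_cells_same_rook_nonadj) (use assms 4 False in simp_all)
      then show ?thesis using 4 by simp
    qed
  qed
qed

lemma flippable_cell_port:
  assumes "3 \<le> q" "a < 3" "i < q" "j < q + 5" "b < 3" "0 < k" "k < q + 5"
  shows "flippable q (Cell a i j) (Port b k)"
proof -
  consider "a \<noteq> b" | "a = b" "k \<noteq> j" | "a = b" "k = j" by blast
  then show ?thesis
  proof cases
    case 1
    then show ?thesis by (intro flippable_cell_port_different_rooks) (use assms in simp_all)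
  next
    case 2
    have "flippable q (Cell a i j) (Port a k)"
      by (rule flippable_cell_port_same_rook_nonadj) (use assms 2 in simp_all)
    then show ?thesis using 2 by simp
  next
    case 3
    have "flippable q (Port a j) (Cell a i j)"
      by (rule flippable_cell_port_adj) (use assms 3 in simp_all)
    then show ?thesis using 3 by (subst flippable_commute) simp
  qed
qed

lemma flippable_cell_apex:
  assumes "3 \<le> q" "a < 3" "i < q" "j < q + 5"
  shows "flippable q (Cell a i j) Apex"
proof (cases "j = 0")
  case True
  then show ?thesis
    using flippable_cell_apex_adj[OF assms(1-3)] by (subst flippable_commute) simp
next
  case False
  then show ?thesis by (intro flippable_cell_apex_nonadj) (use assms in simp_all)
qed

lemma flippable:
  assumes q: "3 \<le> q" and "u \<in> verts_of q" "v \<in> verts_of q" "u \<noteq> v"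
  shows "flippable q u v"
proof -
  note intros = flippable_cells[OF q] flippable_cell_port[OF q] flippable_cell_apex[OF q]
    flippable_ports[OF q] flippable_port_apex[OF q]
  show ?thesis
  proof (cases u)
    case u: (Cell a i j)
    then show ?thesis
      by (cases v; simp only:; intro intros) (use assms in simp_all)
  next
    case u: (Port a j)
    show ?thesis
    proof (cases v)
      case v: (Cell b k l)
      have "flippable q v u"
        unfolding u v by (intro intros) (use assms u v in simp_all)
      then show ?thesis by (subst flippable_commute)
    qed (simp only: u; intro intros; use assms u in simp)+
  next
    case u: Apex
    have "flippable q v u"
      using assms u by (cases v; simp only:; intro intros) simp_all
    then show ?thesis by (subst flippable_commute)
  qed
qed

section \<open>There is no induced cycle of length \<open>2 q + 2\<close>\<close>

text \<open>A putative induced cycle is indexed by all integers modulo its length, so that it can be rotated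
  freely.\<close>
locale rook_hole =
  fixes q :: nat and g :: "int \<Rightarrow> vert" and n :: int
  assumes q: "3 \<le> q" and n: "n = 2 * int q + 2"
    and verts: "g i \<in> verts_of q"
    and eq_iff: "g i = g j \<longleftrightarrow> n dvd j - i"
    and adj_iff: "adj (g i) (g j) \<longleftrightarrow> n dvd j - i - 1 \<or> n dvd i - j - 1"
begin

lemma shift: "rook_hole q (\<lambda>i. g (i + m)) n"
  by unfold_locales (auto simp: q n[symmetric] verts eq_iff adj_iff)

lemma period: "g (i + n) = g i"
  by (simp add: eq_iff)

lemma apart:
  assumes "0 < d" "d < n"
  shows "g i \<noteq> g (i + d)" "adj (g i) (g (i + d)) \<longleftrightarrow> d = 1 \<or> d = n - 1"
proof -
  show "g i \<noteq> g (i + d)" using assms zdvd_imp_le[of n d] by (auto simp: eq_iff)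
  have "n dvd d - 1 \<longleftrightarrow> d = 1"
    using assms zdvd_imp_le[of n "d - 1"] by (cases "d = 1") auto
  moreover have "n dvd - d - 1 \<longleftrightarrow> d = n - 1"
  proof
    assume "n dvd - d - 1"
    then have "n dvd d + 1" using dvd_minus_iff[of n "d + 1"] by simp
    then show "d = n - 1" using assms zdvd_imp_le[of n "d + 1"] by auto
  qed auto
  ultimately show "adj (g i) (g (i + d)) \<longleftrightarrow> d = 1 \<or> d = n - 1"
    by (simp add: adj_iff)
qed

lemma far:
  assumes "1 < j - i" "j - i < n - 1"
  shows "g i \<noteq> g j" "\<not> adj (g i) (g j)"
  using apart[of "j - i" i] assms by simp_all

lemma consecutive: "adj (g i) (g (i + 1))"
  by (simp add: adj_iff)

lemma not_adj_two: "\<not> adj (g i) (g (i + 2))"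
  using apart(2)[of 2 i] q n by simp

lemma same_rook:
  assumes "k \<le> l" "\<And>i. k \<le> i \<Longrightarrow> i \<le> l \<Longrightarrow> is_Cell (g i)"
  shows "rook (g l) = rook (g k)"
  using assms
proof (induction rule: int_ge_induct)
  case (step l)
  have "is_Cell (g l)" "is_Cell (g (l + 1))" using step by auto
  then have "rook (g (l + 1)) = rook (g l)"
    using consecutive[of l] by (cases "g l"; cases "g (l + 1)") auto
  then show ?case using step by simp
qed simp

text \<open>Along a maximal run of cells, steps inside a row and inside a column alternate, and the run
  leaves the two bounding ports by a step inside a row.\<close>
lemma even_run:
  assumes m: "1 \<le> m" "m + 1 < n" and ends: "\<not> is_Cell (g 0)" "\<not> is_Cell (g (m + 1))"
    and cells: "\<And>i. 1 \<le> i \<Longrightarrow> i \<le> m \<Longrightarrow> is_Cell (g i)"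
  shows "even m"
proof -
  have step: "rook (g (i + 1)) = rook (g i)"
    "row (g i) = row (g (i + 1)) \<longleftrightarrow> col (g i) \<noteq> col (g (i + 1))"
    if "1 \<le> i" "i < m" for i
    using consecutive[of i] cells[of i] cells[of "i + 1"] that
    by (cases "g i"; cases "g (i + 1)"; simp)+
  \<comment> \<open>Two row steps or two column steps in succession would put \<open>g i\<close> and
    \<open>g (i + 2)\<close> into one line, which is a chord.\<close>
  have alt: "row (g i) = row (g (i + 1)) \<longleftrightarrow> row (g (i + 1)) \<noteq> row (g (i + 2))"
    if i: "1 \<le> i" "i + 1 < m" for i
  proof -
    have "\<not> adj (g i) (g (i + 2))" "g i \<noteq> g (i + 2)"
      using not_adj_two apart(1)[of 2 i] q n by auto
    moreover have "is_Cell (g i)" "is_Cell (g (i + 2))" using cells i by auto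
    ultimately have "rook (g i) = rook (g (i + 2)) \<longrightarrow>
        row (g i) \<noteq> row (g (i + 2)) \<and> col (g i) \<noteq> col (g (i + 2))"
      by (cases "g i"; cases "g (i + 2)") auto
    then show ?thesis
      using step[of i] step[of "i + 1"] i by (auto simp: add.assoc)
  qed
  have port0: "g 0 = port (rook (g 1)) (col (g 1))"
    using consecutive[of 0] cells[of 1] m ends by (cases "g 0"; cases "g 1") auto
  have portm: "g (m + 1) = port (rook (g m)) (col (g m))"
    using consecutive[of m] cells[of m] m ends by (cases "g m"; cases "g (m + 1)") auto
  \<comment> \<open>A single cell would have the same port before and after it.\<close>
  have "m \<noteq> 1"
    using port0 portm apart(1)[of 2 0] q n by auto
  then have m2: "2 \<le> m" using m by simp
  \<comment> \<open>A first step inside the column would make \<open>g 2\<close> a further cell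
    adjacent to \<open>g 0\<close>; the last step is treated symmetrically.\<close>
  have first: "row (g 1) = row (g 2)"
  proof (rule ccontr)
    assume "row (g 1) \<noteq> row (g 2)"
    then have "g 0 = port (rook (g 2)) (col (g 2))" using step[of 1] m2 port0 by simp
    then have "adj (g 0) (g 2)" using cells[of 2] m2 by (cases "g 2") auto
    then show False using not_adj_two[of 0] by simp
  qed
  have parity: "row (g i) = row (g (i + 1)) \<longleftrightarrow> odd i" if "1 \<le> i" "i < m" for i
    using that
  proof (induction rule: int_ge_induct)
    case (step i)
    then show ?case using alt[of i] by (simp add: add.assoc)
  qed (use first in simp)
  have "row (g (m - 1)) = row (g m)"
  proof (rule ccontr)
    assume "row (g (m - 1)) \<noteq> row (g m)"
    then have "g (m + 1) = port (rook (g (m - 1))) (col (g (m - 1)))"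
      using step[of "m - 1"] m2 portm by simp
    then have "adj (g (m - 1)) (g (m + 1))"
      using cells[of "m - 1"] m2 by (cases "g (m - 1)") auto
    moreover have "1 < m + 1 - (m - 1)" "m + 1 - (m - 1) < n - 1" using q n by simp_all
    ultimately show False using far by blast
  qed
  \<comment> \<open>Row steps start at odd indices, and the last step, which starts at
    \<open>m - 1\<close>, is a row step.\<close>
  then show "even m" using parity[of "m - 1"] m2 by simp
qed

text \<open>The cells at positions \<open>0, 2, ..., 2 * q\<close> are pairwise distinct and
  non-adjacent, since their differences are even and less than \<open>n\<close>, whereas
  \<open>n - 1\<close> is odd. They lie in one rook, so these \<open>q + 1\<close> cells would
  occupy different rows, of which there are only \<open>q\<close>.\<close>

lemma not_all_cells: "\<exists>i. \<not> is_Cell (g i)"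
proof (rule ccontr)
  assume "\<not> ?thesis"
  then have cells: "is_Cell (g i)" for i by blast
  let ?r = "\<lambda>k::nat. row (g (2 * int k))"
  have "?r k \<noteq> ?r l" if "k < l" "l \<le> q" for k l
  proof -
    define d where "d = 2 * (int l - int k)"
    have d: "0 < d" "d < n" "d \<noteq> 1" "d \<noteq> n - 1" "2 * int l = 2 * int k + d"
      using that n by (auto simp: d_def)
    then have "\<not> adj (g (2 * int k)) (g (2 * int l))" "g (2 * int k) \<noteq> g (2 * int l)"
      using apart[of d "2 * int k"] by auto
    moreover have "rook (g (2 * int l)) = rook (g (2 * int k))"
      using same_rook[of "2 * int k" "2 * int l"] cells that by simp
    ultimately show ?thesis
      using cells[of "2 * int k"] cells[of "2 * int l"]
      by (cases "g (2 * int k)"; cases "g (2 * int l)") auto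
  qed
  then have "inj_on ?r {..q}" by (intro linorder_inj_onI) auto
  moreover have "?r ` {..q} \<subseteq> {..<q}"
  proof (intro image_subsetI)
    show "?r k \<in> {..<q}" for k
      using verts[of "2 * int k"] cells[of "2 * int k"] by (cases "g (2 * int k)") auto
  qed
  ultimately have "card {..q} \<le> card {..<q}" by (intro card_inj_on_le) auto
  then show False by simp
qed

section \<open>Ports on a putative induced cycle\<close>

lemma adj_Port: "adj (Port a j) x \<longleftrightarrow> (\<exists>i. x = Cell a i j \<and> 0 < j) \<or> (\<exists>b l. x = Port b l \<and> a \<noteq> b)"
  by (cases x) auto

lemma Apex_unique:
  assumes "g i = Apex" "0 < d" "d < n"
  shows "g (i + d) \<noteq> Apex"
  using apart(1)[OF assms(2,3)] assms(1) by metis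

text \<open>Otherwise both neighbours are cells of the column of the port, hence equal or
  adjacent.\<close>

lemma Port_has_Port_neighbour:
  assumes "is_Port (g i)"
  shows "is_Port (g (i - 1)) \<or> is_Port (g (i + 1))"
proof (rule ccontr)
  assume no: "\<not> ?thesis"
  obtain a j where p: "g i = Port a j" using assms by (cases "g i") auto
  have "adj (Port a j) (g (i + 1))" using consecutive[of i] p by simp
  moreover have "adj (Port a j) (g (i - 1))"
    using consecutive[of "i - 1"] sympD[OF symp_adj] p by fastforce
  ultimately obtain k l where "g (i - 1) = Cell a k j" "g (i + 1) = Cell a l j"
    using no by (auto simp: adj_Port)
  moreover have "1 < i + 1 - (i - 1)" "i + 1 - (i - 1) < n - 1" using q n by simp_all
  then have "g (i - 1) \<noteq> g (i + 1)" "\<not> adj (g (i - 1)) (g (i + 1))"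
    using far by blast+
  ultimately show False by auto
qed

text \<open>Without ports the only non-cell is a single \<open>Apex\<close>. The remaining cells
  then form one run inside a rook, and both neighbours of \<open>Apex\<close> lie in column 0 of it,
  hence are equal or adjacent.\<close>

lemma ex_Port: "\<exists>i. is_Port (g i)"
proof (rule ccontr)
  assume no: "\<not> ?thesis"
  obtain p where "\<not> is_Cell (g p)" using not_all_cells by blast
  moreover have no_port: "\<not> is_Port (g i)" for i using no by blast
  ultimately have p: "g p = Apex" using no_port[of p] by (cases "g p") auto
  have cells: "is_Cell (g (p + d))" if "0 < d" "d < n" for d
    using Apex_unique[OF p that] no_port[of "p + d"] by (cases "g (p + d)") auto
  have rk: "rook (g (p + (n - 1))) = rook (g (p + 1))"
  proof (rule same_rook)
    show "is_Cell (g i)" if "p + 1 \<le> i" "i \<le> p + (n - 1)" for i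
      using cells[of "i - p"] that by simp
  qed (use q n in simp)
  have "adj Apex (g (p + 1))" "adj Apex (g (p + (n - 1)))"
    using apart(2)[of 1 p] apart(2)[of "n - 1" p] p q n by auto
  then have "g (p + 1) = g (p + (n - 1)) \<or> adj (g (p + 1)) (g (p + (n - 1)))"
    using rk cells[of 1] cells[of "n - 1"] q n
    by (cases "g (p + 1)"; cases "g (p + (n - 1))") auto
  moreover have "1 < p + (n - 1) - (p + 1)" "p + (n - 1) - (p + 1) < n - 1" using q n by simp_all
  ultimately show False using far by blast
qed

text \<open>The outer ports are non-adjacent, so they share a rook \<open>a\<close>; any further
  port would be adjacent to the middle one or to both outer ones. Without \<open>Apex\<close> the
  rest is a run of the odd length \<open>n - 3\<close>. With \<open>Apex\<close>, both runs lie in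
  rook \<open>a\<close>, so the neighbours of \<open>Apex\<close> share column 0.\<close>

lemma no_three_Ports:
  assumes "is_Port (g 0)" "is_Port (g 1)" "is_Port (g 2)"
  shows False
proof -
  obtain a j b k c l where p: "g 0 = Port a j" "g 1 = Port b k" "g 2 = Port c l"
    using assms by (metis is_Port_def)
  have ab: "a \<noteq> b" "c = a"
    using consecutive[of 0] not_adj_two[of 0] p by auto
  have n8: "8 \<le> n" using q n by simp
  have no_port: "\<not> is_Port (g i)" if i: "3 \<le> i" "i < n" for i
  proof
    assume "is_Port (g i)"
    then obtain x y where x: "g i = Port x y" by (cases "g i") auto
    have "\<not> adj (g 1) (g i)" using apart(2)[of "i - 1" 1] i by simp
    then have "adj (g 0) (g i)" "adj (g 2) (g i)" using p x ab by auto
    then show False using apart(2)[of i 0] apart(2)[of "i - 2" 2] i n8 by simp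
  qed
  have last: "g n = g 0" using period[of 0] by simp
  show False
  proof (cases "\<exists>i. 3 \<le> i \<and> i < n \<and> g i = Apex")
    case False
    then have cells: "is_Cell (g i)" if "3 \<le> i" "i < n" for i
      using no_port[OF that] that by (cases "g i") auto
    \<comment> \<open>Shifting by 2 puts the bounding ports at 0 and \<open>n - 2\<close>.\<close>
    interpret s: rook_hole q "\<lambda>i. g (i + 2)" n by (rule shift)
    have "even (n - 3)"
      by (rule s.even_run) (use cells n8 p last in simp_all)
    then show False using n by simp
  next
    case True
    then obtain i where i: "3 \<le> i" "i < n" "g i = Apex" by blast
    have "i \<noteq> 3" using consecutive[of 2] i(3) p by auto
    moreover have "i \<noteq> n - 1" using consecutive[of "n - 1"] i(3) p last by auto
    ultimately have i4: "4 \<le> i" "i \<le> n - 2" using i by auto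
    have cells: "is_Cell (g m)" if "3 \<le> m" "m < n" "m \<noteq> i" for m
    proof -
      have "g m \<noteq> Apex"
        using that i Apex_unique[OF i(3), of "m - i"] Apex_unique[of m "i - m"]
        by (cases "m < i") auto
      then show ?thesis using no_port[OF that(1,2)] by (cases "g m") auto
    qed
    have "rook (g (i - 1)) = rook (g 3)"
      by (rule same_rook) (use cells i i4 in auto)
    moreover have "rook (g (n - 1)) = rook (g (i + 1))"
      by (rule same_rook) (use cells i i4 in auto)
    moreover have "rook (g 3) = a"
      using consecutive[of 2] p ab cells[of 3] i4 n8 by (auto simp: adj_Port)
    moreover have "rook (g (n - 1)) = a"
      using consecutive[of "n - 1"] p last cells[of "n - 1"] i4 n8 by (cases "g (n - 1)") auto
    ultimately have rk: "rook (g (i - 1)) = rook (g (i + 1))" by simp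
    have c: "is_Cell (g (i - 1))" "is_Cell (g (i + 1))" using cells i4 by simp_all
    have "adj (g (i - 1)) Apex" "adj Apex (g (i + 1))"
      using consecutive[of "i - 1"] consecutive[of i] i(3) by simp_all
    then have "g (i - 1) = g (i + 1) \<or> adj (g (i - 1)) (g (i + 1))"
      using rk c by (cases "g (i - 1)"; cases "g (i + 1)") auto
    moreover have "1 < i + 1 - (i - 1)" "i + 1 - (i - 1) < n - 1" using n8 by simp_all
    ultimately show False using far by blast
  qed
qed

text \<open>A further port would be adjacent to neither of the two and so belong to both of their
  rooks. Without \<open>Apex\<close> the remaining run would start in rook \<open>b\<close> and end
  in rook \<open>a\<close>. With \<open>Apex\<close> at \<open>i\<close>, the runs of lengths
  \<open>i - 2\<close> and \<open>n - i - 1\<close> are both even, yet their sum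
  \<open>n - 3\<close> is odd.\<close>

lemma no_two_Ports:
  assumes "is_Port (g 0)" "is_Port (g 1)" "\<not> is_Port (g 2)" "\<not> is_Port (g (- 1))"
  shows False
proof -
  obtain a j b k where p: "g 0 = Port a j" "g 1 = Port b k"
    using assms by (metis is_Port_def)
  have ab: "a \<noteq> b" using consecutive[of 0] p by auto
  have n8: "8 \<le> n" using q n by simp
  have last: "g n = g 0" "g (n - 1) = g (- 1)"
    using period[of 0] period[of "- 1"] by simp_all
  have no_port: "\<not> is_Port (g i)" if i: "2 \<le> i" "i < n" for i
  proof
    assume port: "is_Port (g i)"
    then obtain x y where x: "g i = Port x y" by (cases "g i") auto
    have "i \<noteq> 2" "i \<noteq> n - 1" using port assms last by auto
    then have "\<not> adj (g 0) (g i)" "\<not> adj (g 1) (g i)"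
      using apart(2)[of i 0] apart(2)[of "i - 1" 1] i by auto
    then show False using p x ab by auto
  qed
  have e2: "adj (Port b k) (g 2)" using consecutive[of 1] p by simp
  have en: "adj (g (n - 1)) (Port a j)" using consecutive[of "n - 1"] p last by simp
  have rook2: "is_Cell (g 2)" "rook (g 2) = b"
    using e2 no_port[of 2] n8 by (auto simp: adj_Port)
  have rookn: "is_Cell (g (n - 1))" "rook (g (n - 1)) = a"
    using en no_port[of "n - 1"] n8 by (cases "g (n - 1)"; auto)+
  show False
  proof (cases "\<exists>i. 2 \<le> i \<and> i < n \<and> g i = Apex")
    case False
    then have cells: "is_Cell (g i)" if "2 \<le> i" "i < n" for i
      using no_port[OF that] that by (cases "g i") auto
    have "rook (g (n - 1)) = rook (g 2)"
      by (rule same_rook) (use cells n8 in auto)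
    then show False using rook2 rookn ab by simp
  next
    case True
    then obtain i where i: "2 \<le> i" "i < n" "g i = Apex" by blast
    have "i \<noteq> 2" "i \<noteq> n - 1" using i(3) rook2 rookn by auto
    then have i3: "3 \<le> i" "i \<le> n - 2" using i by auto
    have cells: "is_Cell (g m)" if "2 \<le> m" "m < n" "m \<noteq> i" for m
    proof -
      have "g m \<noteq> Apex"
        using that i Apex_unique[OF i(3), of "m - i"] Apex_unique[of m "i - m"]
        by (cases "m < i") auto
      then show ?thesis using no_port[OF that(1,2)] by (cases "g m") auto
    qed
    interpret s: rook_hole q "\<lambda>x. g (x + 1)" n by (rule shift)
    interpret t: rook_hole q "\<lambda>x. g (x + i)" n by (rule shift)
    have "even (i - 2)"
      by (rule s.even_run) (use cells i i3 p in simp_all)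
    moreover have "even (n - i - 1)"
      by (rule t.even_run) (use cells i i3 p last in simp_all)
    ultimately show False using n by simp
  qed
qed

text \<open>Some port has a port neighbour. A third consecutive port is excluded on either side by
  rotation, so the pair is isolated and \<open>no_two_Ports\<close> applies.\<close>

lemma no_hole: False
proof -
  obtain i where i: "is_Port (g i)" using ex_Port by blast
  have "\<exists>i. is_Port (g i) \<and> is_Port (g (i + 1))"
    using Port_has_Port_neighbour[OF i] i by (metis diff_add_cancel)
  then obtain m where m: "is_Port (g m)" "is_Port (g (m + 1))" by blast
  interpret s: rook_hole q "\<lambda>x. g (x + m)" n by (rule shift)
  interpret t: rook_hole q "\<lambda>x. g (x + (m - 1))" n by (rule shift)
  have "\<not> is_Port (g (m + 2))"
    using s.no_three_Ports m by (auto simp: add.commute)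
  moreover have "\<not> is_Port (g (m - 1))"
    using t.no_three_Ports m by (auto simp: add.commute)
  ultimately show False
    using s.no_two_Ports m by (auto simp: add.commute)
qed

end

section \<open>Saturation of the constructed graph\<close>

lemma no_hole_verts_of:
  assumes q: "3 \<le> q"
  shows "\<not> hole (verts_of q) adj (2 * q + 2) h"
proof
  let ?n = "2 * q + 2"
  assume h: "hole (verts_of q) adj ?n h"
  \<comment> \<open>Reduction modulo the length extends the cycle periodically to all
    integers.\<close>
  define ix where "ix i = nat (i mod int ?n)" for i
  have ix: "ix i < ?n" "int (ix i) = i mod int ?n" for i
    by (auto simp: ix_def nat_less_iff)
  have suc: "ix j = Suc (ix i) mod ?n \<longleftrightarrow> int ?n dvd j - i - 1" for i j
  proof -
    have "ix j = Suc (ix i) mod ?n \<longleftrightarrow> int (ix j) = int (Suc (ix i) mod ?n)" by simp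
    also have "int (Suc (ix i) mod ?n) = (i + 1) mod int ?n"
      by (simp only: zmod_int of_nat_Suc ix(2) mod_add_left_eq add.commute[of 1])
    also have "int (ix j) = (i + 1) mod int ?n \<longleftrightarrow> int ?n dvd j - i - 1"
      by (simp only: ix(2) mod_eq_dvd_iff diff_diff_eq)
    finally show ?thesis .
  qed
  have "rook_hole q (\<lambda>i. h (ix i)) (int ?n)"
  proof
    fix i j
    show "h (ix i) \<in> verts_of q" using h ix(1) unfolding hole_def by blast
    have "h (ix i) = h (ix j) \<longleftrightarrow> ix i = ix j"
      using inj_on_eq_iff[of h "{..<?n}" "ix i" "ix j"] h ix(1)[of i] ix(1)[of j]
      unfolding hole_def by simp
    also have "\<dots> \<longleftrightarrow> j mod int ?n = i mod int ?n" by (metis ix(2) of_nat_eq_iff)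
    also have "\<dots> \<longleftrightarrow> int ?n dvd j - i" by (rule mod_eq_dvd_iff)
    finally show "h (ix i) = h (ix j) \<longleftrightarrow> int ?n dvd j - i" .
    show "adj (h (ix i)) (h (ix j)) \<longleftrightarrow> int ?n dvd j - i - 1 \<or> int ?n dvd i - j - 1"
      using h ix(1) suc unfolding hole_def by blast
  qed (use q in auto)
  then show False by (rule rook_hole.no_hole)
qed

theorem theorem1p1:
  fixes q :: nat
  assumes "q \<ge> 3"
  shows "\<exists>G :: nat pair_pre_digraph.
           pair_graph G \<and> card (pverts G) \<ge> 2 \<and>
           induced_saturated (cycle_graph (2 * q + 2)) G"
proof (intro exI conjI)
  let ?V = "verts_of q"
  let ?G = "graph_of ?V adj"
  note B = finite_verts_of symp_adj irreflp_adj
  show "pair_graph ?G" by (rule pair_graph_graph_of[OF B])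
  \<comment> \<open>Two distinct vertices suffice to rule out vacuous saturation.\<close>
  have "{Apex, Port 0 1} \<subseteq> ?V" by simp
  then have "card {Apex, Port 0 1} \<le> card ?V" by (intro card_mono B)
  moreover have "card (pverts ?G) = card ?V" by (simp add: graph_of_def card_image)
  ultimately show "card (pverts ?G) \<ge> 2" by simp
  show "induced_saturated (cycle_graph (2 * q + 2)) ?G"
    unfolding induced_saturated_def
  proof (intro conjI ballI impI)
    show "\<not> has_induced_copy (cycle_graph (2 * q + 2)) ?G"
      using has_induced_copy_graph_of[OF B, of "2 * q + 2"] no_hole_verts_of assms by auto
    fix x y assume "x \<in> pverts ?G" "y \<in> pverts ?G" "x \<noteq> y"
    then obtain u v where uv: "u \<in> ?V" "v \<in> ?V" "u \<noteq> v" "x = to_nat u" "y = to_nat v"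
      by (auto simp: graph_of_def)
    have "has_induced_copy (cycle_graph (2 * q + 2)) (graph_of ?V (flip_rel u v adj))"
      using flippable[OF assms uv(1-3)] assms
        has_induced_copy_graph_of[OF finite_verts_of symp_flip_rel[OF symp_adj]
          irreflp_flip_rel[OF irreflp_adj uv(3)], of "2 * q + 2"] by simp
    then show "has_induced_copy (cycle_graph (2 * q + 2)) (flip_adjacency x y ?G)"
      unfolding uv(4,5) flip_adjacency_graph_of[OF symp_adj uv(1,2)] .
  qed
qed

end
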